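(* Assume (A1), (A2) and (A3) (as defined in the context). Then the McKean–Vlasov SDE $\mathrm dX_t=b(X_t,\mathscr L_{X_t})\,\mathrm dt+\mathrm dZ_t$ has a stationary distribution $\pi$ with finite $\beta^*$-th moment, i.e. $\pi(|\cdot|^{\beta^*})<\infty$, where $\beta^*=\beta+\theta_1-1$ with $\beta,\theta_1$ from (A1).
   Context: Setting. $d\ge1$; $\mathscr P(\mathbb R^d)$ is the set of Borel probability measures on $\mathbb R^d$, $\mu(f):=\int f\,\mathrm d\mu$; for $p>0$, $\mathscr P_p=\{\mu\in\mathscr P(\mathbb R^d):\mu(|\cdot|^p)<\infty\}$ and for $M>0$, $\mathscr P_p^M=\{\mu\in\mathscr P_p:\mu(|\cdot|^p)\le M\}$. For $r\ge0$, $V_r(x)=(1+|x|^2)^{r/2}$. $(Z_t)_{t\ge0}$ is a $d$-dimensional pure jump Lévy process whose Lévy measure $\nu$ satisfies $\nu(|\cdot|^2\mathbf 1_{\{|\cdot|\le1\}})+\nu(|\cdot|^{\beta_*}\mathbf 1_{\{|\cdot|>1\}})<\infty$ for some $\beta_*\in(0,2]$. $b:\mathbb R^d\times\mathscr P(\mathbb R^d)\to\mathbb R^d$, and the McKean–Vlasov SDE $\mathrm dX_t=b(X_t,\mathscr L_{X_t})\mathrm dt+\mathrm dZ_t$ (with $\mathscr L_{X_t}$ the law of $X_t$) is assumed strongly well-posed. A stationary distribution of this SDE is a $\pi$ such that $\mathscr L_{X_0}=\pi$ implies $\mathscr L_{X_t}=\pi$ for all $t\ge0$. For fixed $\mu$,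 $(Y^\mu_t)_{t\ge0}$ solves the (linear) SDE $\mathrm dY^\mu_t=b(Y^\mu_t,\mu)\mathrm dt+\mathrm dZ_t$, $(P^\mu_t)$ is its Markov semigroup and $\mu_0P^\mu_t$ denotes the law of $Y^\mu_t$ when $\mathscr L_{Y^\mu_0}=\mu_0$; IPM means invariant probability measure. (A1): there are constants $\beta\in(0,\beta_*]$, $\lambda_1,\lambda_2,C_b,\theta_1,\theta_3,\theta_4>0$, $\theta_2\ge0$ with $\theta_1\ge1-\beta/2$, $\theta_2<1+\theta_1$, $\theta_3\in(0,\beta^*]$, where $\beta^*:=\beta+\theta_1-1$ and $\gamma_1:=(\beta+\theta_2-2)^+/\beta^*\in[0,1)$, and either (i) $\beta^*(1-\gamma_1)>\theta_3\theta_4$, or (ii) $\beta^*(1-\gamma_1)=\theta_3\theta_4$ and $\lambda_1>\lambda_2$, such that for all $x\in\mathbb R^d$, $\mu\in\mathscr P_{\beta^*}$: $\langle x,b(x,\mu)\rangle\le C_b-\lambda_1|x|^{1+\theta_1}+\lambda_2(1+|x|^2)^{\theta_2/2}\mu(|\cdot|^{\theta_3})^{\theta_4}$. (A2): for every $\mu\in\mathscr P_{\beta^*}$, $(Y^\mu_t)$ is a $C_b$-Feller process (its semigroup maps bounded continuous functions to bounded continuous functions) and has a unique IPM $\pi^\mu$. (A3): there is a constant $M^*>0$ such that $\pi^\mu\in\mathscr P^{M^*}_{\beta^*}$ for every $\mu\in\mathscr P^{M^*}_{\beta^*}$ (such constants exist under (A1),(A2) by Lemma 2.2 of the paper), and the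 map $\mathscr P^{M^*}_{\beta^*}\ni\mu\mapsto\pi^\mu$ is weakly continuous. *)

theory Defs
  imports "HOL-Probability.Probability"
begin

definition prob_measures :: "'a::euclidean_space measure set" where
  "prob_measures = {\<mu>. prob_space \<mu> \<and> sets \<mu> = sets borel}"

definition moment :: "'a::euclidean_space measure \<Rightarrow> real \<Rightarrow> ennreal" where
  "moment \<mu> p = (\<integral>\<^sup>+ x. ennreal (norm x powr p) \<partial>\<mu>)"

definition P_mom :: "real \<Rightarrow> 'a::euclidean_space measure set" where
  "P_mom p = {\<mu> \<in> prob_measures. moment \<mu> p < \<infinity>}"

definition P_mom_le :: "real \<Rightarrow> real \<Rightarrow> 'a::euclidean_space measure set" where
  "P_mom_le p M = {\<mu> \<in> prob_measures. moment \<mu> p \<le> ennreal M}"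

definition weak_conv_seq :: "(nat \<Rightarrow> 'a::euclidean_space measure) \<Rightarrow> 'a measure \<Rightarrow> bool" where
  "weak_conv_seq \<mu>s \<mu> \<longleftrightarrow>
     (\<forall>f::'a \<Rightarrow> real. continuous_on UNIV f \<and> bounded (range f) \<longrightarrow>
        (\<lambda>n. \<integral>x. f x \<partial>(\<mu>s n)) \<longlonglongrightarrow> (\<integral>x. f x \<partial>\<mu>))"

definition cadlag :: "(real \<Rightarrow> 'a::topological_space) \<Rightarrow> bool" where
  "cadlag f \<longleftrightarrow> (\<forall>t\<ge>0. continuous (at_right t) f \<and> (t > 0 \<longrightarrow> (\<exists>l. (f \<longlongrightarrow> l) (at_left t))))"

definition levy_measure :: "'a::euclidean_space measure \<Rightarrow> real \<Rightarrow> bool" where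
  "levy_measure \<nu> \<beta>s \<longleftrightarrow> sets \<nu> = sets borel \<and> emeasure \<nu> {0} = 0 \<and>
     (\<integral>\<^sup>+ z. ennreal ((norm z)\<^sup>2 * indicator {z. norm z \<le> 1} z) \<partial>\<nu>) < \<infinity> \<and>
     (\<integral>\<^sup>+ z. ennreal (norm z powr \<beta>s * indicator {z. norm z > 1} z) \<partial>\<nu>) < \<infinity>"

text \<open>Characteristic exponent of the pure jump Levy process with triplet (0,0,nu).\<close>
definition levy_exponent :: "'a::euclidean_space measure \<Rightarrow> 'a \<Rightarrow> complex" where
  "levy_exponent \<nu> \<xi> =
     (\<integral>z. cis (\<xi> \<bullet> z) - 1 - \<i> * complex_of_real (\<xi> \<bullet> z) * indicator {z. norm z \<le> 1} z \<partial>\<nu>)"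

definition filtr :: "'w measure \<Rightarrow> (real \<Rightarrow> 'w measure) \<Rightarrow> bool" where
  "filtr M F \<longleftrightarrow> (\<forall>t\<ge>0. subalgebra M (F t)) \<and>
                 (\<forall>s t. 0 \<le> s \<longrightarrow> s \<le> t \<longrightarrow> sets (F s) \<subseteq> sets (F t))"

definition levy_process ::
  "'w measure \<Rightarrow> (real \<Rightarrow> 'w measure) \<Rightarrow> 'a::euclidean_space measure \<Rightarrow> (real \<Rightarrow> 'w \<Rightarrow> 'a) \<Rightarrow> bool" where
  "levy_process M F \<nu> Z \<longleftrightarrow>
     (\<forall>t\<ge>0. Z t \<in> F t \<rightarrow>\<^sub>M borel) \<and>
     (\<forall>\<omega>\<in>space M. Z 0 \<omega> = 0) \<and>
     (AE \<omega> in M. cadlag (\<lambda>t. Z t \<omega>)) \<and>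
     (\<forall>s t. 0 \<le> s \<longrightarrow> s \<le> t \<longrightarrow>
        prob_space.indep_sets M
          (\<lambda>i::bool. if i then sets (F s)
                     else {(\<lambda>\<omega>. Z t \<omega> - Z s \<omega>) -` A \<inter> space M | A. A \<in> sets borel}) UNIV \<and>
        (\<forall>\<xi>. (\<integral>\<omega>. cis (\<xi> \<bullet> (Z t \<omega> - Z s \<omega>)) \<partial>M) = exp (complex_of_real (t - s) * levy_exponent \<nu> \<xi>)))"

definition driving_setup ::
  "'w measure \<Rightarrow> (real \<Rightarrow> 'w measure) \<Rightarrow> 'a::euclidean_space measure \<Rightarrow> (real \<Rightarrow> 'w \<Rightarrow> 'a) \<Rightarrow> bool" where
  "driving_setup M F \<nu> Z \<longleftrightarrow> prob_space M \<and> filtr M F \<and> levy_process M F \<nu> Z"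

definition sde_solution ::
  "'w measure \<Rightarrow> (real \<Rightarrow> 'w measure) \<Rightarrow> (real \<Rightarrow> 'w \<Rightarrow> 'a::euclidean_space) \<Rightarrow> (real \<Rightarrow> 'a \<Rightarrow> 'a)
    \<Rightarrow> (real \<Rightarrow> 'w \<Rightarrow> 'a) \<Rightarrow> bool" where
  "sde_solution M F Z B X \<longleftrightarrow>
     (\<forall>t\<ge>0. X t \<in> F t \<rightarrow>\<^sub>M borel) \<and>
     (AE \<omega> in M. cadlag (\<lambda>t. X t \<omega>) \<and>
        (\<forall>t\<ge>0. set_integrable lborel {0..t} (\<lambda>s. B s (X s \<omega>)) \<and>
               X t \<omega> = X 0 \<omega> + (LINT s:{0..t}|lborel. B s (X s \<omega>)) + Z t \<omega>))"

definition mv_solution ::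
  "'w measure \<Rightarrow> (real \<Rightarrow> 'w measure) \<Rightarrow> (real \<Rightarrow> 'w \<Rightarrow> 'a::euclidean_space)
    \<Rightarrow> ('a \<Rightarrow> 'a measure \<Rightarrow> 'a) \<Rightarrow> (real \<Rightarrow> 'w \<Rightarrow> 'a) \<Rightarrow> bool" where
  "mv_solution M F Z b X \<longleftrightarrow> sde_solution M F Z (\<lambda>s x. b x (distr M borel (X s))) X"

definition lin_solution ::
  "'w measure \<Rightarrow> (real \<Rightarrow> 'w measure) \<Rightarrow> (real \<Rightarrow> 'w \<Rightarrow> 'a::euclidean_space)
    \<Rightarrow> ('a \<Rightarrow> 'a measure \<Rightarrow> 'a) \<Rightarrow> 'a measure \<Rightarrow> (real \<Rightarrow> 'w \<Rightarrow> 'a) \<Rightarrow> bool" where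
  "lin_solution M F Z b \<mu> Y \<longleftrightarrow> sde_solution M F Z (\<lambda>s x. b x \<mu>) Y"

definition mv_strongly_well_posed ::
  "'a::euclidean_space measure \<Rightarrow> ('a \<Rightarrow> 'a measure \<Rightarrow> 'a) \<Rightarrow> 'w itself \<Rightarrow> bool" where
  "mv_strongly_well_posed \<nu> b _ \<longleftrightarrow>
     (\<forall>(M::'w measure) F Z \<xi>. driving_setup M F \<nu> Z \<and> \<xi> \<in> F 0 \<rightarrow>\<^sub>M borel \<longrightarrow>
        (\<exists>X. mv_solution M F Z b X \<and> (\<forall>\<omega>\<in>space M. X 0 \<omega> = \<xi> \<omega>))) \<and>
     (\<forall>(M::'w measure) F Z X X'. driving_setup M F \<nu> Z \<and> mv_solution M F Z b X \<and> mv_solution M F Z b X'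
        \<and> (AE \<omega> in M. X 0 \<omega> = X' 0 \<omega>) \<longrightarrow> (AE \<omega> in M. \<forall>t\<ge>0. X t \<omega> = X' t \<omega>))"

text \<open>Strong existence for the linear SDE with frozen measure mu (implicit in the paper:
  the process Y^mu exists for any initial value).\<close>
definition lin_strong_existence ::
  "'a::euclidean_space measure \<Rightarrow> ('a \<Rightarrow> 'a measure \<Rightarrow> 'a) \<Rightarrow> 'a measure \<Rightarrow> 'w itself \<Rightarrow> bool" where
  "lin_strong_existence \<nu> b \<mu> _ \<longleftrightarrow>
     (\<forall>(M::'w measure) F Z \<xi>. driving_setup M F \<nu> Z \<and> \<xi> \<in> F 0 \<rightarrow>\<^sub>M borel \<longrightarrow>
        (\<exists>Y. lin_solution M F Z b \<mu> Y \<and> (\<forall>\<omega>\<in>space M. Y 0 \<omega> = \<xi> \<omega>)))"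

text \<open>C_b-Feller property of (Y^mu_t): for every t \<ge> 0 and bounded continuous f,
  P^mu_t f (x) = E f(Y^{mu,x}_t) is well defined (independent of the realisation) and
  continuous in x.\<close>
definition lin_Cb_Feller ::
  "'a::euclidean_space measure \<Rightarrow> ('a \<Rightarrow> 'a measure \<Rightarrow> 'a) \<Rightarrow> 'a measure \<Rightarrow> 'w itself \<Rightarrow> bool" where
  "lin_Cb_Feller \<nu> b \<mu> _ \<longleftrightarrow>
     (\<forall>t\<ge>0. \<forall>f::'a \<Rightarrow> real. continuous_on UNIV f \<and> bounded (range f) \<longrightarrow>
        (\<exists>g. continuous_on UNIV g \<and> bounded (range g) \<and>
           (\<forall>(M::'w measure) F Z Y x. driving_setup M F \<nu> Z \<and> lin_solution M F Z b \<mu> Y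
               \<and> (\<forall>\<omega>\<in>space M. Y 0 \<omega> = x) \<longrightarrow> (\<integral>\<omega>. f (Y t \<omega>) \<partial>M) = g x)))"

definition lin_ipm ::
  "'a::euclidean_space measure \<Rightarrow> ('a \<Rightarrow> 'a measure \<Rightarrow> 'a) \<Rightarrow> 'a measure \<Rightarrow> 'w itself \<Rightarrow> 'a measure \<Rightarrow> bool" where
  "lin_ipm \<nu> b \<mu> W \<pi> \<longleftrightarrow> \<pi> \<in> prob_measures \<and>
     (\<forall>(M::'w measure) F Z Y. driving_setup M F \<nu> Z \<and> lin_solution M F Z b \<mu> Y
        \<and> distr M borel (Y 0) = \<pi> \<longrightarrow> (\<forall>t\<ge>0. distr M borel (Y t) = \<pi>))"

definition ipm_of ::
  "'a::euclidean_space measure \<Rightarrow> ('a \<Rightarrow> 'a measure \<Rightarrow> 'a) \<Rightarrow> 'w itself \<Rightarrow> 'a measure \<Rightarrow> 'a measure" where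
  "ipm_of \<nu> b W \<mu> = (THE \<pi>. lin_ipm \<nu> b \<mu> W \<pi>)"

definition mv_stationary ::
  "'a::euclidean_space measure \<Rightarrow> ('a \<Rightarrow> 'a measure \<Rightarrow> 'a) \<Rightarrow> 'w itself \<Rightarrow> 'a measure \<Rightarrow> bool" where
  "mv_stationary \<nu> b _ \<pi> \<longleftrightarrow> \<pi> \<in> prob_measures \<and>
     (\<forall>(M::'w measure) F Z X. driving_setup M F \<nu> Z \<and> mv_solution M F Z b X
        \<and> distr M borel (X 0) = \<pi> \<longrightarrow> (\<forall>t\<ge>0. distr M borel (X t) = \<pi>))"

end

theory Submission
  imports Defs
begin

text \<open>
  A fixed point \<open>\<pi>\<close> of \<open>\<mu> \<mapsto> \<pi>\<^sup>\<mu>\<close> is stationary: the solution of the linear SDE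
  with frozen measure \<open>\<pi>\<close> started in the law \<open>\<pi>\<close> keeps this law, hence solves the
  McKean-Vlasov SDE, and pathwise uniqueness identifies it with every other solution.

  Such a fixed point comes from Schauder's argument on the convex, weakly compact set of
  probability measures with bounded moment. Brouwer's theorem is needed in unbounded dimension,
  so it is derived from Kuhn's lemma for cubes indexed by natural numbers. Sequential weak
  compactness on \<open>\<real>\<^sup>d\<close> is reduced to Helly's selection theorem on \<open>\<real>\<close>: a space-filling
  curve \<open>\<real> \<rightarrow> \<real>\<^sup>d\<close> has a Borel right inverse, so tight sequences can be moved to the line
  and their limits pushed back by continuity.
\<close>

section \<open>Brouwer's theorem on cubes of arbitrary dimension\<close>

text \<open>Coordinatewise Bolzano-Weierstrass: each new coordinate refines the subsequence found so
  far. Points are functions on the naturals, so the dimension \<open>n\<close> is a number and can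
  vary inside a proof.\<close>

lemma bounded_coordinates_convergent_subsequence:
  fixes X :: "nat \<Rightarrow> nat \<Rightarrow> real"
  assumes "\<And>k i. i < n \<Longrightarrow> X k i \<in> {0..1}"
  shows "\<exists>r z. strict_mono (r :: nat \<Rightarrow> nat) \<and> (\<forall>i<n. (\<lambda>k. X (r k) i) \<longlonglongrightarrow> z i)"
  using assms
proof (induction n)
  case 0
  show ?case by (intro exI[of _ "\<lambda>k. k"]) (auto simp: strict_mono_def)
next
  case (Suc n)
  then obtain r z where r: "strict_mono r" "\<forall>i<n. (\<lambda>k. X (r k) i) \<longlonglongrightarrow> z i" by force
  have "\<forall>k. X (r k) n \<in> {0..1}" using Suc.prems by auto
  then obtain l r' where r': "strict_mono (r' :: nat \<Rightarrow> nat)" "((\<lambda>k. X (r k) n) \<circ> r') \<longlonglongrightarrow> l"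
    using compact_Icc[of 0 "1::real"] unfolding compact_def by meson
  have "(\<lambda>k. X ((r \<circ> r') k) i) \<longlonglongrightarrow> (z(n := l)) i" if "i < Suc n" for i
  proof (cases "i = n")
    case False
    then have "(\<lambda>k. X (r k) i) \<longlonglongrightarrow> z i" using r that by auto
    from LIMSEQ_subseq_LIMSEQ[OF this r'(1)] False show ?thesis by (simp add: o_def)
  qed (use r' in \<open>simp add: o_def\<close>)
  then show ?case using strict_mono_o[OF r(1) r'(1)]
    by (intro exI[of _ "r \<circ> r'"] exI[of _ "z(n := l)"] conjI allI impI)
qed

text \<open>On finer and finer grids Kuhn's lemma finds, for each coordinate, nearby points at which
  \<open>f\<close> moves that coordinate weakly up and weakly down; a limit of the grid points is
  fixed. The sequential continuity assumption looks only at coordinates below \<open>n\<close>, so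
  on the cube it also makes \<open>f x i\<close> independent of the others.\<close>

lemma brouwer_unit_cube_sequences:
  fixes f :: "(nat \<Rightarrow> real) \<Rightarrow> nat \<Rightarrow> real"
  assumes maps: "\<And>x i. (\<And>j. j < n \<Longrightarrow> x j \<in> {0..1}) \<Longrightarrow> i < n \<Longrightarrow> f x i \<in> {0..1}"
    and cont: "\<And>X x i. (\<And>k j. j < n \<Longrightarrow> X k j \<in> {0..1}) \<Longrightarrow> (\<And>j. j < n \<Longrightarrow> (\<lambda>k. X k j) \<longlonglongrightarrow> x j)
      \<Longrightarrow> i < n \<Longrightarrow> (\<lambda>k. f (X k) i) \<longlonglongrightarrow> f x i"
  shows "\<exists>x. (\<forall>i<n. x i \<in> {0..1}) \<and> (\<forall>i<n. f x i = x i)"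
proof -
  define P where "P x \<longleftrightarrow> (\<forall>i<n. x i \<in> {0..1})" for x :: "nat \<Rightarrow> real"
  \<comment> \<open>The label \<open>l x i\<close> records a direction: 0 guarantees that
    \<open>f\<close> does not lower coordinate \<open>i\<close>, 1 that it does not raise it. On the
    two faces of the cube the label is forced.\<close>
  have "\<exists>l. (\<forall>x i. l x i \<le> (1::nat)) \<and>
             (\<forall>x i. P x \<and> i < n \<and> x i = 0 \<longrightarrow> l x i = 0) \<and>
             (\<forall>x i. P x \<and> i < n \<and> x i = 1 \<longrightarrow> l x i = 1) \<and>
             (\<forall>x i. P x \<and> i < n \<and> l x i = 0 \<longrightarrow> x i \<le> (\<lambda>i. if i < n then f x i else 0) i) \<and>
             (\<forall>x i. P x \<and> i < n \<and> l x i = 1 \<longrightarrow> (\<lambda>i. if i < n then f x i else 0) i \<le> x i)"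
  proof (rule kuhn_labelling_lemma')
    show "\<forall>x. P x \<longrightarrow> P (\<lambda>i. if i < n then f x i else 0)"
    proof (intro allI impI)
      fix x assume "P x"
      then have "f x i \<in> {0..1}" if "i < n" for i using maps[of x i] that unfolding P_def by blast
      then show "P (\<lambda>i. if i < n then f x i else 0)" unfolding P_def by simp
    qed
    show "\<forall>x. P x \<longrightarrow> (\<forall>i. i < n \<longrightarrow> 0 \<le> x i \<and> x i \<le> 1)"
      unfolding P_def by simp
  qed
  then obtain l :: "(nat \<Rightarrow> real) \<Rightarrow> nat \<Rightarrow> nat" where L: "\<forall>x i. l x i \<le> 1"
      "\<forall>x i. P x \<and> i < n \<and> x i = 0 \<longrightarrow> l x i = 0"
      "\<forall>x i. P x \<and> i < n \<and> x i = 1 \<longrightarrow> l x i = 1"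
      "\<forall>x i. P x \<and> i < n \<and> l x i = 0 \<longrightarrow> x i \<le> (if i < n then f x i else 0)"
      "\<forall>x i. P x \<and> i < n \<and> l x i = 1 \<longrightarrow> (if i < n then f x i else 0) \<le> x i"
    by (elim exE conjE) (rule that)
  have l01: "l x i = 0 \<or> l x i = 1" for x i using L(1)[rule_format, of x i] by linarith
  have l: "l x i = 0" if "P x" "i < n" "x i = 0" for x i using L(2) that by simp
  have l': "l x i = 1" if "P x" "i < n" "x i = 1" for x i using L(3) that by simp
  have lf: "x i \<le> f x i" if "P x" "i < n" "l x i = 0" for x i
    using L(4)[rule_format, of x i] that by simp
  have lf': "f x i \<le> x i" if "P x" "i < n" "l x i = 1" for x i
    using L(5)[rule_format, of x i] that by simp
  \<comment> \<open>Kuhn's lemma gives a grid cube of side \<open>1 / Suc k\<close> in which, for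
    each \<open>i\<close>, two corners have different \<open>i\<close>-labels. The points
    \<open>u i\<close> and \<open>v i\<close> depend on \<open>i\<close>, but all lie within the
    mesh of one point \<open>z\<close>.\<close>
  have "\<exists>z u v. P z \<and> (\<forall>i<n. P (u i) \<and> P (v i) \<and>
      (\<forall>j<n. \<bar>u i j - z j\<bar> \<le> 1 / Suc k \<and> \<bar>v i j - z j\<bar> \<le> 1 / Suc k) \<and>
      u i i \<le> f (u i) i \<and> f (v i) i \<le> v i i)" for k
  proof -
    define p where "p = Suc k"
    define g :: "(nat \<Rightarrow> nat) \<Rightarrow> nat \<Rightarrow> real" where "g x = (\<lambda>i. real (x i) / real p)" for x
    have p: "p > 0" by (simp add: p_def)
    have gP: "P (g x)" if "\<forall>i<n. x i \<le> p" for x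
      using that p by (auto simp: P_def g_def)
    have g01: "x i = 0 \<Longrightarrow> g x i = 0" "x i = p \<Longrightarrow> g x i = 1" for x i using p by (auto simp: g_def)
    obtain q where q: "\<forall>i<n. q i < p"
      and rs: "\<forall>i<n. \<exists>r s. (\<forall>j<n. q j \<le> r j \<and> r j \<le> q j + 1) \<and> (\<forall>j<n. q j \<le> s j \<and> s j \<le> q j + 1) \<and>
        l (g r) i \<noteq> l (g s) i"
    proof (rule kuhn_lemma[of p n "\<lambda>x. l (g x)"])
      show "\<forall>x. (\<forall>i<n. x i \<le> p) \<longrightarrow> (\<forall>i<n. x i = 0 \<longrightarrow> l (g x) i = 0)"
        using l gP g01 by blast
      show "\<forall>x. (\<forall>i<n. x i \<le> p) \<longrightarrow> (\<forall>i<n. x i = p \<longrightarrow> l (g x) i = 1)"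
        using l' gP g01 by blast
    qed (use p l01 in simp_all)
    have "\<exists>u v. P u \<and> P v \<and> (\<forall>j<n. \<bar>u j - g q j\<bar> \<le> 1 / Suc k \<and> \<bar>v j - g q j\<bar> \<le> 1 / Suc k) \<and>
      u i \<le> f u i \<and> f v i \<le> v i" if i: "i < n" for i
    proof -
      have near: "P (g r)" "\<forall>j<n. \<bar>g r j - g q j\<bar> \<le> 1 / Suc k" if "\<forall>j<n. q j \<le> r j \<and> r j \<le> q j + 1" for r
      proof -
        show "P (g r)" using that q by (intro gP) force
        show "\<forall>j<n. \<bar>g r j - g q j\<bar> \<le> 1 / Suc k"
        proof (intro allI impI)
          fix j assume "j < n"
          then have "\<bar>real (r j) - real (q j)\<bar> \<le> 1" using that by force
          then show "\<bar>g r j - g q j\<bar> \<le> 1 / Suc k"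
            by (simp add: g_def p_def abs_divide divide_right_mono flip: diff_divide_distrib del: of_nat_Suc)
        qed
      qed
      obtain r s where rs: "\<forall>j<n. q j \<le> r j \<and> r j \<le> q j + 1" "\<forall>j<n. q j \<le> s j \<and> s j \<le> q j + 1"
        "l (g r) i \<noteq> l (g s) i" using rs i by blast
      then have "l (g r) i = 0 \<and> l (g s) i = 1 \<or> l (g r) i = 1 \<and> l (g s) i = 0"
        using l01 by metis
      then show ?thesis
      proof
        assume "l (g r) i = 0 \<and> l (g s) i = 1"
        then show ?thesis using near[OF rs(1)] near[OF rs(2)] lf lf' i
          by (intro exI[of _ "g r"] exI[of _ "g s"]) auto
      next
        assume "l (g r) i = 1 \<and> l (g s) i = 0"
        then show ?thesis using near[OF rs(1)] near[OF rs(2)] lf lf' i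
          by (intro exI[of _ "g s"] exI[of _ "g r"]) auto
      qed
    qed
    then obtain u v where "\<forall>i<n. P (u i) \<and> P (v i) \<and> (\<forall>j<n. \<bar>u i j - g q j\<bar> \<le> 1 / Suc k \<and> \<bar>v i j - g q j\<bar> \<le> 1 / Suc k) \<and>
      u i i \<le> f (u i) i \<and> f (v i) i \<le> v i i" by metis
    moreover have "P (g q)" using q by (intro gP) auto
    ultimately show ?thesis by (intro exI[of _ "g q"] exI[of _ u] exI[of _ v] conjI)
  qed
  then obtain z u v where z: "\<And>k. P (z k)" and uv: "\<And>k i. i < n \<Longrightarrow> P (u k i) \<and> P (v k i) \<and>
      (\<forall>j<n. \<bar>u k i j - z k j\<bar> \<le> 1 / Suc k \<and> \<bar>v k i j - z k j\<bar> \<le> 1 / Suc k) \<and>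
      u k i i \<le> f (u k i) i \<and> f (v k i) i \<le> v k i i" by metis
  obtain r x where r: "strict_mono (r :: nat \<Rightarrow> nat)" and x: "\<forall>i<n. (\<lambda>k. z (r k) i) \<longlonglongrightarrow> x i"
    using bounded_coordinates_convergent_subsequence[of n z] z unfolding P_def by blast
  have lim: "(\<lambda>k. y (r k) j) \<longlonglongrightarrow> x j" if "\<And>k. \<bar>y k j - z k j\<bar> \<le> 1 / Suc k" "j < n" for y :: "nat \<Rightarrow> nat \<Rightarrow> real" and j
  proof -
    have "(\<lambda>k. 1 / Suc k) \<longlonglongrightarrow> (0::real)" using LIMSEQ_inverse_real_of_nat by (simp add: inverse_eq_divide)
    then have "(\<lambda>k. y k j - z k j) \<longlonglongrightarrow> 0" by (rule Lim_null_comparison[rotated]) (use that in auto)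
    from LIMSEQ_subseq_LIMSEQ[OF this r] have "(\<lambda>k. y (r k) j - z (r k) j) \<longlonglongrightarrow> 0" by (simp add: o_def)
    from tendsto_add[OF this x[rule_format, OF that(2)]] show ?thesis by simp
  qed
  have "x i \<in> {0..1}" if "i < n" for i
    using closed_sequentially[OF closed_atLeastAtMost, of "\<lambda>k. z (r k) i" 0 1 "x i"] x z that by (auto simp: P_def)
  moreover have "f x i = x i" if i: "i < n" for i
  proof -
    have U: "(\<lambda>k. u (r k) i j) \<longlonglongrightarrow> x j" "(\<lambda>k. v (r k) i j) \<longlonglongrightarrow> x j" if "j < n" for j
      using lim[of "\<lambda>k. u k i" j] lim[of "\<lambda>k. v k i" j] uv i that by auto
    have P01: "u k i j \<in> {0..1}" "v k i j \<in> {0..1}" if "j < n" for k j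
      using uv[OF i, of k] that by (simp_all add: P_def)
    have "x i \<le> f x i"
    proof (rule LIMSEQ_le[OF U(1)[OF i]])
      show "(\<lambda>k. f (u (r k) i) i) \<longlonglongrightarrow> f x i" by (rule cont) (use P01 U i in simp_all)
    qed (use uv i in simp)
    moreover have "f x i \<le> x i"
    proof (rule LIMSEQ_le[OF _ U(2)[OF i]])
      show "(\<lambda>k. f (v (r k) i) i) \<longlonglongrightarrow> f x i" by (rule cont) (use P01 U i in simp_all)
    qed (use uv i in simp)
    ultimately show ?thesis by simp
  qed
  ultimately show ?thesis by (intro exI[of _ x] conjI allI impI)
qed

section \<open>A space-filling curve and weak compactness\<close>

text \<open>The doubling map generates the digits: \<open>y k\<close> is the remainder after
  \<open>k\<close> digits, magnified by \<open>2 ^ k\<close>. It stays in the closed unit interval,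
  and 1 receives the expansion with all digits 1.\<close>

lemma binary_expansion:
  fixes x :: real
  assumes "x \<in> {0..1}"
  shows "\<exists>a :: nat \<Rightarrow> nat. (\<forall>k. a k \<in> {0, 1}) \<and> (\<lambda>k. real (a k) / 2 ^ Suc k) sums x"
proof -
  define y where "y = rec_nat x (\<lambda>_ z. if z \<ge> 1/2 then 2 * z - 1 else 2 * z)"
  define a :: "nat \<Rightarrow> nat" where "a k = (if y k \<ge> 1/2 then 1 else 0)" for k
  have y0: "y 0 = x" and yS: "y (Suc k) = 2 * y k - real (a k)" for k
    by (auto simp: y_def a_def)
  have y01: "y k \<in> {0..1}" for k
    by (induction k) (use assms y0 yS in \<open>auto simp: a_def\<close>)
  have part: "(\<Sum>k<n. real (a k) / 2 ^ Suc k) = x - y n / 2 ^ n" for n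
    by (induction n) (auto simp: y0 yS field_simps)
  have "(\<lambda>n. y n / 2 ^ n) \<longlonglongrightarrow> 0"
  proof (rule Lim_null_comparison)
    show "(\<lambda>n. (1/2) ^ n :: real) \<longlonglongrightarrow> 0" by (rule LIMSEQ_realpow_zero) auto
    show "\<forall>\<^sub>F n in sequentially. norm (y n / 2 ^ n) \<le> (1/2) ^ n"
      using y01 by (auto simp: power_one_over divide_simps)
  qed
  then have "(\<lambda>n. x - y n / 2 ^ n) \<longlonglongrightarrow> x - 0" by (intro tendsto_intros)
  then have "(\<lambda>k. real (a k) / 2 ^ Suc k) sums x" unfolding sums_def part by simp
  moreover have "a k \<in> {0, 1}" for k by (simp add: a_def)
  ultimately show ?thesis by blast
qed

section \<open>Schoenberg's digit function and digit series\<close>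

text \<open>This is the distance to the nearest even integer; written with \<open>arccos\<close> and
  \<open>cos\<close>, it is visibly continuous and 2-periodic.\<close>

definition triangle_wave :: "real \<Rightarrow> real" where
  "triangle_wave t = arccos (cos (pi * t)) / pi"

lemma triangle_wave_periodic: "triangle_wave (2 * real n + t) = triangle_wave t"
proof -
  have "cos (pi * (2 * real n + t)) = cos (pi * t)"
    using cos_int_2pin[of "int n"] sin_int_2pin[of "int n"]
    by (simp add: distrib_left cos_add mult_ac)
  then show ?thesis by (simp add: triangle_wave_def)
qed

lemma triangle_wave_unit: "t \<in> {0..1} \<Longrightarrow> triangle_wave t = t"
  by (simp add: triangle_wave_def arccos_cos)

lemma continuous_on_triangle_wave [continuous_intros]:
  fixes f :: "'a::t2_space \<Rightarrow> real"
  shows "continuous_on A f \<Longrightarrow> continuous_on A (\<lambda>x. triangle_wave (f x))"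
  unfolding triangle_wave_def
  by (intro continuous_on_divide continuous_on_arccos continuous_on_cos continuous_on_mult continuous_on_const) auto

text \<open>On the unit interval the value is 0 on the first third and 1 on the last, with linear
  interpolation between. On the Cantor set it is therefore half the leading ternary digit.\<close>

definition ternary_digit :: "real \<Rightarrow> real" where
  "ternary_digit t = min 1 (max 0 (3 * triangle_wave t - 1))"

lemma ternary_digit_bounds: "0 \<le> ternary_digit t" "ternary_digit t \<le> 1"
  by (auto simp: ternary_digit_def)

lemma ternary_digit_periodic: "ternary_digit (2 * real n + t) = ternary_digit t"
  by (simp add: ternary_digit_def triangle_wave_periodic)

lemma continuous_on_ternary_digit [continuous_intros]:
  fixes f :: "'a::t2_space \<Rightarrow> real"
  shows "continuous_on A f \<Longrightarrow> continuous_on A (\<lambda>x. ternary_digit (f x))"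
  unfolding ternary_digit_def by (intro continuous_intros)

text \<open>The witness is the Cantor point with ternary digits \<open>2 * a k\<close>.
  Multiplication by \<open>3 ^ m\<close> turns the first \<open>m\<close> digits into an even
  integer, which the period 2 removes, so that digit \<open>m\<close> comes to the front.\<close>

lemma ternary_digit_of_expansion:
  fixes a :: "nat \<Rightarrow> nat"
  assumes "\<And>k. a k \<in> {0, 1}"
  shows "\<exists>t\<in>{0..1}. \<forall>m. ternary_digit (3 ^ m * t) = real (a m)"
proof -
  define S where "S a = (\<Sum>k. 2 * real (a k) / 3 ^ Suc k)" for a :: "nat \<Rightarrow> nat"
  define D where "D = {a :: nat \<Rightarrow> nat. \<forall>k. a k \<in> {0, 1}}"
  have geo: "(\<lambda>k. 2 / 3 ^ Suc k) sums (1::real)"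
    using sums_mult[OF geometric_sums[of "1/3::real"], of "2/3"] by (simp add: power_one_over)
  have le: "2 * real (a k) / 3 ^ Suc k \<le> 2 / 3 ^ Suc k" if "a \<in> D" for a k
  proof -
    have "a k \<le> 1" using that by (auto simp: D_def le_Suc_eq)
    then show ?thesis by (simp add: divide_right_mono)
  qed
  have summ: "summable (\<lambda>k. 2 * real (a k) / 3 ^ Suc k)" if "a \<in> D" for a
    by (rule summable_comparison_test'[OF sums_summable[OF geo], of 0]) (use le[OF that] in simp)
  have S01: "S a \<in> {0..1}" if "a \<in> D" for a
  proof -
    have "S a \<le> (\<Sum>k. 2 / 3 ^ Suc k)"
      unfolding S_def by (rule suminf_le[OF le[OF that] summ[OF that] sums_summable[OF geo]])
    moreover have "0 \<le> S a"
      unfolding S_def by (rule suminf_nonneg[OF summ[OF that]]) simp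
    ultimately show ?thesis using sums_unique[OF geo] by simp
  qed
  have shift: "3 * S a = 2 * real (a 0) + S (\<lambda>k. a (Suc k))" if "a \<in> D" for a
  proof -
    have "S a = 2 * real (a 0) / 3 + (\<Sum>k. 2 * real (a (Suc k)) / 3 ^ Suc (Suc k))"
      using suminf_split_initial_segment[OF summ[OF that], of 1] by (simp add: S_def)
    also have "(\<Sum>k. 2 * real (a (Suc k)) / 3 ^ Suc (Suc k)) = S (\<lambda>k. a (Suc k)) / 3"
      unfolding S_def using that
      by (subst suminf_divide[symmetric]) (auto intro!: summ[unfolded power_Suc] simp: D_def)
    finally show ?thesis by simp
  qed
  \<comment> \<open>The first digit decides whether \<open>S a\<close> lies in the first or the last
    third of the unit interval, where \<open>ternary_digit\<close> is constant.\<close>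
  have digit: "ternary_digit (S a) = real (a 0)" if a: "a \<in> D" for a
  proof -
    have "(\<lambda>k. a (Suc k)) \<in> D" using a by (simp add: D_def)
    then have "S (\<lambda>k. a (Suc k)) \<in> {0..1}" by (rule S01)
    moreover have "a 0 = 0 \<or> a 0 = 1" using a by (auto simp: D_def)
    ultimately show ?thesis
      using shift[OF a] triangle_wave_unit[OF S01[OF a]] by (auto simp: ternary_digit_def)
  qed
  have split: "\<exists>K::nat. 3 ^ m * S a = 2 * real K + S (\<lambda>k. a (k + m))" if "a \<in> D" for a m
    using that
  proof (induction m arbitrary: a)
    case 0
    show ?case by (intro exI[of _ 0]) simp
  next
    case (Suc m)
    have "(\<lambda>k. a (Suc k)) \<in> D" using Suc.prems by (simp add: D_def)
    from Suc.IH[OF this] obtain K :: nat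
      where K: "3 ^ m * S (\<lambda>k. a (Suc k)) = 2 * real K + S (\<lambda>k. a (k + Suc m))" by auto
    have "3 ^ Suc m * S a = 3 ^ m * (3 * S a)" by simp
    also have "\<dots> = 2 * real (3 ^ m * a 0 + K) + S (\<lambda>k. a (k + Suc m))"
      unfolding shift[OF Suc.prems] distrib_left K by simp
    finally show ?case by blast
  qed
  have "ternary_digit (3 ^ m * S a) = real (a m)" if a: "a \<in> D" for a m
  proof -
    obtain K where "3 ^ m * S a = 2 * real K + S (\<lambda>k. a (k + m))" using split[OF a] by blast
    moreover have "(\<lambda>k. a (k + m)) \<in> D" using a by (simp add: D_def)
    ultimately show ?thesis using digit[of "\<lambda>k. a (k + m)"] by (simp add: ternary_digit_periodic)
  qed
  moreover have "a \<in> D" using assms by (simp add: D_def)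
  ultimately show ?thesis using S01 by blast
qed

text \<open>For different residues \<open>e < d\<close> the series read disjoint sets of digits of
  \<open>t\<close>, so \<open>d\<close> coordinates can be prescribed independently by a single
  parameter.\<close>

definition digit_series :: "nat \<Rightarrow> nat \<Rightarrow> real \<Rightarrow> real" where
  "digit_series d e t = (\<Sum>k. ternary_digit (3 ^ (k * d + e) * t) / 2 ^ Suc k)"

lemma continuous_on_digit_series: "continuous_on UNIV (digit_series d e)"
proof -
  have "uniform_limit UNIV (\<lambda>n t. \<Sum>k<n. ternary_digit (3 ^ (k * d + e) * t) / 2 ^ Suc k)
      (\<lambda>t. \<Sum>k. ternary_digit (3 ^ (k * d + e) * t) / 2 ^ Suc k) sequentially"
  proof (rule Weierstrass_m_test)
    show "norm (ternary_digit (3 ^ (k * d + e) * t) / 2 ^ Suc k) \<le> (1/2) ^ Suc k" for k t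
      using ternary_digit_bounds[of "3 ^ (k * d + e) * t"] by (simp add: divide_simps)
    show "summable (\<lambda>k. (1/2) ^ Suc k :: real)" using summable_mult[OF summable_geometric, of "1/2::real" "1/2"] by simp
  qed
  then show ?thesis unfolding digit_series_def[abs_def]
    by (rule uniform_limit_theorem[rotated]) (auto intro!: always_eventually continuous_intros)
qed

text \<open>Schoenberg's space-filling curve, with its copies on the intervals \<open>[2n, 2n+1]\<close> magnified
  to fill the cube \<open>[-n, n]\<^sup>d\<close>.\<close>

lemma space_filling_curve:
  "\<exists>G :: real \<Rightarrow> 'a::euclidean_space. continuous_on UNIV G \<and>
     (\<forall>n x. n \<ge> 1 \<longrightarrow> norm x \<le> real n \<longrightarrow> x \<in> G ` {0..2 * real n + 1})"
proof -
  define d where "d = DIM('a)"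
  have "\<exists>h. bij_betw h (Basis :: 'a set) {..<d}"
    using ex_bij_betw_finite_nat[OF finite_Basis] by (auto simp: d_def atLeast0LessThan)
  then obtain e :: "'a \<Rightarrow> nat" where e: "bij_betw e Basis {..<d}" by auto
  \<comment> \<open>\<open>w\<close> is constantly \<open>n\<close> on the interval from
    \<open>2 * n\<close> to \<open>2 * n + 1\<close> and interpolates continuously in between; it
    supplies the magnification.\<close>
  define w where "w t = (t - triangle_wave t) / 2" for t
  define G :: "real \<Rightarrow> 'a" where
    "G t = (\<Sum>b\<in>Basis. (w t * (2 * digit_series d (e b) t - 1)) *\<^sub>R b)" for t
  have "continuous_on UNIV G"
    unfolding G_def w_def by (intro continuous_intros continuous_on_digit_series) auto
  moreover have "x \<in> G ` {0..2 * real n + 1}" if n: "n \<ge> 1" and x: "norm x \<le> real n" for n x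
  proof -
    have "(x \<bullet> b / n + 1) / 2 \<in> {0..1}" if "b \<in> Basis" for b
    proof -
      have "\<bar>x \<bullet> b\<bar> \<le> real n" using Basis_le_norm[OF that, of x] x by linarith
      then have "\<bar>x \<bullet> b / n\<bar> \<le> 1" using n by simp
      then show ?thesis by (simp add: abs_le_iff del: abs_divide)
    qed
    from binary_expansion[OF this] obtain a :: "'a \<Rightarrow> nat \<Rightarrow> nat"
      where a: "\<And>b k. b \<in> Basis \<Longrightarrow> a b k \<in> {0, 1}"
        "\<And>b. b \<in> Basis \<Longrightarrow> (\<lambda>k. real (a b k) / 2 ^ Suc k) sums ((x \<bullet> b / n + 1) / 2)"
      by metis
    \<comment> \<open>The binary digits of the rescaled coordinates are interleaved: position
      \<open>k * d + e b\<close> holds digit \<open>k\<close> of coordinate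
      \<open>b\<close>.\<close>
    define A where "A m = a (inv_into Basis e (m mod d)) (m div d)" for m
    have d0: "d > 0" by (simp add: d_def)
    have "inv_into Basis e (m mod d) \<in> Basis" for m
      using bij_betwE[OF bij_betw_inv_into[OF e], rule_format, of "m mod d"] d0 by simp
    then obtain t where t: "t \<in> {0..1}" "\<And>m. ternary_digit (3 ^ m * t) = real (A m)"
      using ternary_digit_of_expansion[of A] a(1) unfolding A_def by blast
    have Ae: "A (k * d + e b) = a b k" if b: "b \<in> Basis" for b k
    proof -
      have "e b < d" using bij_betwE[OF e] b by auto
      moreover have "inv_into Basis e (e b) = b" using e b by (simp add: bij_betw_def)
      ultimately show ?thesis by (simp add: A_def)
    qed
    have w: "w (2 * real n + t) = n" using t by (simp add: w_def triangle_wave_periodic triangle_wave_unit)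
    have "digit_series d (e b) (2 * real n + t) = (x \<bullet> b / n + 1) / 2" if b: "b \<in> Basis" for b
    proof -
      \<comment> \<open>Since \<open>3 ^ m * (2 * n)\<close> is an even integer, shifting the
        parameter by \<open>2 * n\<close> changes no digit.\<close>
      have "ternary_digit (3 ^ m * (2 * real n + t)) = real (A m)" for m
        using ternary_digit_periodic[of "3 ^ m * n" "3 ^ m * t"] t(2)[of m] by (simp add: algebra_simps)
      then show ?thesis using sums_unique[OF a(2)[OF b]] by (simp add: digit_series_def Ae[OF b])
    qed
    then have "G (2 * real n + t) = (\<Sum>b\<in>Basis. (x \<bullet> b) *\<^sub>R b)"
      unfolding G_def w using n by (intro sum.cong) (auto simp: field_simps)
    then have "G (2 * real n + t) = x" by (simp add: euclidean_representation)
    then show ?thesis using t(1) by (intro image_eqI[of _ _ "2 * real n + t"]) auto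
  qed
  ultimately show ?thesis by blast
qed

text \<open>The least nonnegative preimage is a Borel section, because its sublevel set at
  \<open>c\<close> is the compact image of \<open>{0..c}\<close> under \<open>G\<close>. The bound
  for \<open>s\<close> on balls is what transports tightness to the line.\<close>

lemma space_filling_curve_borel_section:
  "\<exists>(G :: real \<Rightarrow> 'a::euclidean_space) s. continuous_on UNIV G \<and> s \<in> borel_measurable borel \<and>
     (\<forall>x. G (s x) = x) \<and> (\<forall>n x. n \<ge> 1 \<longrightarrow> norm x \<le> real n \<longrightarrow> s x \<in> {0..2 * real n + 1})"
proof -
  obtain G :: "real \<Rightarrow> 'a" where cont: "continuous_on UNIV G"
    and fill: "\<And>n x. n \<ge> 1 \<Longrightarrow> norm x \<le> real n \<Longrightarrow> x \<in> G ` {0..2 * real n + 1}"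
    using space_filling_curve by blast
  define F where "F x = {t. 0 \<le> t \<and> G t = x}" for x
  define s where "s x = Inf (F x)" for x
  have cl: "closed (F x)" for x
  proof -
    have "F x = {0..} \<inter> G -` {x}" by (auto simp: F_def)
    then show ?thesis using cont by (auto intro!: closed_Int continuous_closed_vimage simp: continuous_on_eq_continuous_at)
  qed
  have bdd: "bdd_below (F x)" for x by (auto simp: F_def)
  have ne: "F x \<noteq> {}" for x
  proof -
    obtain m where "norm x \<le> real m" using real_arch_simple by blast
    then have "norm x \<le> real (Suc m)" by simp
    then show ?thesis using fill[of "Suc m" x] by (auto simp: F_def)
  qed
  have sF: "s x \<in> F x" for x unfolding s_def by (rule closed_contains_Inf[OF ne bdd cl])
  have le: "{x. s x \<le> c} = G ` {0..c}" for c
  proof safe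
    fix x assume "s x \<le> c"
    then show "x \<in> G ` {0..c}" using sF[of x] by (intro image_eqI[of _ _ "s x"]) (auto simp: F_def)
  next
    fix t assume "t \<in> {0..c}"
    then have "t \<in> F (G t)" "t \<le> c" by (auto simp: F_def)
    then show "s (G t) \<le> c" unfolding s_def using cInf_lower[OF _ bdd] by fastforce
  qed
  have "s \<in> borel_measurable borel"
  proof (rule borel_measurableI_le)
    fix c
    have "compact (G ` {0..c})" by (rule compact_continuous_image[OF continuous_on_subset[OF cont]]) auto
    then show "{x \<in> space borel. s x \<le> c} \<in> sets borel" using le by (simp add: borel_closed compact_imp_closed)
  qed
  moreover have "s x \<in> {0..2 * real n + 1}" if "n \<ge> 1" "norm x \<le> real n" for n x
    using fill[OF that] sF[of x] le[of "2 * real n + 1"] by (auto simp: F_def)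
  ultimately show ?thesis using cont sF by (intro exI[of _ G] exI[of _ s]) (auto simp: F_def)
qed

section \<open>Sequential Prokhorov theorem on Euclidean space\<close>

text \<open>The images under \<open>s\<close> are tight on the line and have a weakly convergent
  subsequence there. Pushing forward by the continuous \<open>G\<close> preserves weak convergence,
  and \<open>G (s x) = x\<close> recovers the original measures. Only measurability of
  \<open>s\<close> enters.\<close>

lemma tight_imp_weakly_convergent_subsequence:
  fixes \<mu> :: "nat \<Rightarrow> 'a::euclidean_space measure"
  assumes \<mu>: "\<And>n. \<mu> n \<in> prob_measures"
    and tight: "\<And>\<epsilon>. \<epsilon> > 0 \<Longrightarrow> \<exists>R. \<forall>n. measure (\<mu> n) {x. R < norm x} < \<epsilon>"
  shows "\<exists>r \<mu>'. strict_mono (r :: nat \<Rightarrow> nat) \<and> \<mu>' \<in> prob_measures \<and> weak_conv_seq (\<mu> \<circ> r) \<mu>'"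
proof -
  obtain G :: "real \<Rightarrow> 'a" and s where cont: "continuous_on UNIV G" and s: "s \<in> borel_measurable borel"
    and Gs: "\<And>x. G (s x) = x" and sn: "\<And>n x. n \<ge> 1 \<Longrightarrow> norm x \<le> real n \<Longrightarrow> s x \<in> {0..2 * real n + 1}"
    using space_filling_curve_borel_section by metis
  have G: "G \<in> borel_measurable borel" using cont by (rule borel_measurable_continuous_onI)
  have sets_\<mu> [measurable_cong]: "sets (\<mu> n) = sets borel" for n using \<mu> by (simp add: prob_measures_def)
  have space_\<mu>: "space (\<mu> n) = UNIV" for n using sets_eq_imp_space_eq[OF sets_\<mu>] by simp
  have ps: "prob_space (\<mu> n)" for n using \<mu> by (simp add: prob_measures_def)
  define \<rho> where "\<rho> n = distr (\<mu> n) borel s" for n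
  have s_meas [measurable]: "s \<in> \<mu> n \<rightarrow>\<^sub>M borel" for n using s by simp
  have rd: "real_distribution (\<rho> n)" for n
    unfolding \<rho>_def by (rule prob_space.real_distribution_distr[OF ps s_meas])
  have "tight \<rho>"
    unfolding tight_def
  proof (intro conjI allI impI rd)
    fix \<epsilon> :: real assume "\<epsilon> > 0"
    then obtain R where R: "\<And>n. measure (\<mu> n) {x. R < norm x} < \<epsilon>" using tight by blast
    obtain m where "R \<le> real m" using real_arch_simple by blast
    \<comment> \<open>\<open>Suc m\<close> ensures the radius is at least 1, as the bound on
      \<open>s\<close> requires. The left end -1 keeps 0 inside the half-open interval that
      \<open>tight\<close> asks for.\<close>
    define c where "c = 2 * real (Suc m) + 1"
    have "measure (\<rho> n) {-1<..c} > 1 - \<epsilon>" for n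
    proof -
      interpret prob_space "\<mu> n" by (rule ps)
      have "space (\<mu> n) - {x. R < norm x} \<subseteq> s -` {-1<..c} \<inter> space (\<mu> n)"
      proof
        fix x assume "x \<in> space (\<mu> n) - {x. R < norm x}"
        then have "norm x \<le> real (Suc m)" using \<open>R \<le> real m\<close> by simp
        from sn[OF _ this] show "x \<in> s -` {-1<..c} \<inter> space (\<mu> n)" by (simp add: c_def space_\<mu>)
      qed
      then have "prob (space (\<mu> n) - {x. R < norm x}) \<le> prob (s -` {-1<..c} \<inter> space (\<mu> n))"
        by (intro finite_measure_mono) auto
      moreover have "prob (space (\<mu> n) - {x. R < norm x}) = 1 - prob {x. R < norm x}"
        by (rule prob_compl) (simp add: sets_\<mu>)
      moreover have "measure (\<rho> n) {-1<..c} = prob (s -` {-1<..c} \<inter> space (\<mu> n))"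
        unfolding \<rho>_def by (rule measure_distr) auto
      ultimately show ?thesis using R[of n] by simp
    qed
    moreover have "-1 < c" by (simp add: c_def)
    ultimately show "\<exists>a b. a < b \<and> (\<forall>n. 1 - \<epsilon> < measure (\<rho> n) {a<..b})" by blast
  qed
  from tight_imp_convergent_subsubsequence[OF this, of "\<lambda>n. n"]
  obtain r \<rho>' where r: "strict_mono (r :: nat \<Rightarrow> nat)" and \<rho>': "real_distribution \<rho>'"
    and wc: "weak_conv_m (\<rho> \<circ> (\<lambda>n. n) \<circ> r) \<rho>'" by (auto simp: strict_mono_def)
  interpret \<rho>': real_distribution \<rho>' by (rule \<rho>')
  define \<mu>' where "\<mu>' = distr \<rho>' borel G"
  have G': "G \<in> \<rho>' \<rightarrow>\<^sub>M borel" using G by simp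
  have "\<mu>' \<in> prob_measures"
    unfolding \<mu>'_def prob_measures_def using \<rho>'.prob_space_distr[OF G'] by simp
  moreover have "weak_conv_seq (\<mu> \<circ> r) \<mu>'"
    unfolding weak_conv_seq_def
  proof (intro allI impI, elim conjE)
    fix f :: "'a \<Rightarrow> real" assume f: "continuous_on UNIV f" "bounded (range f)"
    have f_meas: "f \<in> borel_measurable borel" using f(1) by (rule borel_measurable_continuous_onI)
    obtain B where B: "\<And>x. norm (f x) \<le> B" using f(2) by (auto simp: bounded_iff)
    have "continuous_on UNIV (\<lambda>t. f (G t))"
      by (rule continuous_on_compose2[OF f(1) cont]) auto
    then have "isCont (\<lambda>t. f (G t)) t" for t by (simp add: continuous_on_eq_continuous_at)
    then have "(\<lambda>n. \<integral>t. f (G t) \<partial>(\<rho> \<circ> (\<lambda>n. n) \<circ> r) n) \<longlonglongrightarrow> (\<integral>t. f (G t) \<partial>\<rho>')"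
      by (intro weak_conv_imp_integral_bdd_continuous_conv[where B = B] wc B) (auto simp: rd \<rho>')
    moreover have "(\<integral>t. f (G t) \<partial>\<rho> n) = (\<integral>x. f x \<partial>\<mu> n)" for n
      unfolding \<rho>_def by (subst integral_distr) (use f_meas G in \<open>auto simp: Gs\<close>)
    moreover have "(\<integral>t. f (G t) \<partial>\<rho>') = (\<integral>x. f x \<partial>\<mu>')"
      unfolding \<mu>'_def by (subst integral_distr[OF G']) (use f_meas in auto)
    ultimately show "(\<lambda>n. \<integral>x. f x \<partial>(\<mu> \<circ> r) n) \<longlonglongrightarrow> (\<integral>x. f x \<partial>\<mu>')" by simp
  qed
  ultimately show ?thesis using r by blast
qed

section \<open>Measures with bounded moment\<close>

lemma prob_measures_space: "\<mu> \<in> prob_measures \<Longrightarrow> space \<mu> = UNIV"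
  using sets_eq_imp_space_eq[of \<mu> borel] by (simp add: prob_measures_def)

lemma prob_measures_integrable_continuous:
  fixes f :: "'a::euclidean_space \<Rightarrow> real"
  assumes \<mu>: "\<mu> \<in> prob_measures" and f: "continuous_on UNIV f" "\<And>x. \<bar>f x\<bar> \<le> B"
  shows "integrable \<mu> f"
proof -
  interpret prob_space \<mu> using \<mu> by (simp add: prob_measures_def)
  have "f \<in> borel_measurable \<mu>"
    using \<mu> borel_measurable_continuous_onI[OF f(1)] by (simp add: prob_measures_def cong: measurable_cong_sets)
  then show ?thesis by (intro integrable_const_bound[of _ B]) (use f(2) in auto)
qed

text \<open>Indicators of closed sets are limits of the Lipschitz functions
  \<open>max 0 (1 - n * infdist x A)\<close>, and closed sets form an intersection-stable generator.
  Lipschitz test functions suit the later argument because their oscillation at a given scale is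
  explicit.\<close>

lemma prob_measures_eqI_bounded_lipschitz:
  fixes \<mu> \<nu> :: "'a::euclidean_space measure"
  assumes \<mu>: "\<mu> \<in> prob_measures" and \<nu>: "\<nu> \<in> prob_measures"
    and eq: "\<And>f L B. (\<And>x y. \<bar>f x - f y\<bar> \<le> L * dist x y) \<Longrightarrow> (\<And>x. \<bar>f x\<bar> \<le> B) \<Longrightarrow> L \<ge> 0
      \<Longrightarrow> (\<integral>x. f x \<partial>\<mu>) = (\<integral>x. f x \<partial>\<nu>)"
  shows "\<mu> = \<nu>"
proof -
  interpret M: prob_space \<mu> using \<mu> by (simp add: prob_measures_def)
  interpret N: prob_space \<nu> using \<nu> by (simp add: prob_measures_def)
  have s: "sets \<mu> = sets borel" "sets \<nu> = sets borel" using \<mu> \<nu> by (auto simp: prob_measures_def)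
  have closed_eq: "measure \<mu> A = measure \<nu> A" if A: "closed A" "A \<noteq> {}" for A
  proof -
    define f where "f n x = max 0 (1 - real n * infdist x A)" for n and x :: 'a
    have lip: "\<bar>f n x - f n y\<bar> \<le> real n * dist x y" for n x y
    proof -
      have "\<bar>f n x - f n y\<bar> \<le> \<bar>real n * (infdist x A - infdist y A)\<bar>"
        by (auto simp: f_def max_def algebra_simps)
      also have "\<dots> \<le> real n * dist x y"
        using infdist_triangle_abs[of x A y] by (simp add: abs_mult mult_left_mono)
      finally show ?thesis .
    qed
    have b: "\<bar>f n x\<bar> \<le> 1" for n x by (auto simp: f_def infdist_nonneg)
    have fm [measurable]: "f n \<in> borel_measurable borel" for n
      unfolding f_def by (intro borel_measurable_continuous_onI continuous_intros)
    have lim: "(\<lambda>n. f n x) \<longlonglongrightarrow> indicator A x" for x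
    proof (cases "x \<in> A")
      case True
      then show ?thesis by (simp add: f_def)
    next
      case False
      then have "infdist x A > 0" using A in_closed_iff_infdist_zero[of A x] infdist_nonneg[of x A] by auto
      then obtain m where m: "1 < real m * infdist x A" using reals_Archimedean3 by blast
      have "f n x = 0" if "n \<ge> m" for n
        using m mult_right_mono[of "real m" "real n" "infdist x A"] that infdist_nonneg[of x A] by (simp add: f_def)
      then have "\<forall>\<^sub>F n in sequentially. f n x = 0" unfolding eventually_sequentially by blast
      then show ?thesis using False by (simp add: tendsto_eventually)
    qed
    have Ab: "A \<in> sets borel" using A by simp
    have "(\<lambda>n. \<integral>x. f n x \<partial>\<mu>) \<longlonglongrightarrow> (\<integral>x. indicator A x \<partial>\<mu>)"
      by (rule integral_dominated_convergence[where w = "\<lambda>_. 1"])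
        (use s fm lim b Ab in \<open>auto cong: measurable_cong_sets\<close>)
    moreover have "(\<lambda>n. \<integral>x. f n x \<partial>\<nu>) \<longlonglongrightarrow> (\<integral>x. indicator A x \<partial>\<nu>)"
      by (rule integral_dominated_convergence[where w = "\<lambda>_. 1"])
        (use s fm lim b Ab in \<open>auto cong: measurable_cong_sets\<close>)
    moreover have "(\<integral>x. f n x \<partial>\<mu>) = (\<integral>x. f n x \<partial>\<nu>)" for n by (rule eq[OF lip b]) simp
    ultimately have "(\<integral>x. indicator A x \<partial>\<mu>) = (\<integral>x. indicator A x \<partial>\<nu> :: real)"
      using LIMSEQ_unique by simp
    then show ?thesis using Ab s by (simp add: prob_measures_space[OF \<mu>] prob_measures_space[OF \<nu>])
  qed
  show ?thesis
  proof (rule measure_eqI_generator_eq[where A = "\<lambda>_. UNIV" and E = "Collect closed" and \<Omega> = UNIV])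
    show "Int_stable (Collect closed)" by (auto simp: Int_stable_def)
    show "emeasure \<mu> X = emeasure \<nu> X" if "X \<in> Collect closed" for X
      using closed_eq[of X] that by (cases "X = {}") (auto simp: M.emeasure_eq_measure N.emeasure_eq_measure)
    show "sets \<mu> = sigma_sets UNIV (Collect closed)" "sets \<nu> = sigma_sets UNIV (Collect closed)"
      using s by (simp_all add: borel_eq_closed)
  qed auto
qed

text \<open>Markov's inequality. The bound is uniform over \<open>P_mom_le p M\<close>, hence gives
  tightness.\<close>

lemma P_mom_le_tail:
  fixes \<mu> :: "'a::euclidean_space measure"
  assumes \<mu>: "\<mu> \<in> P_mom_le p M" and "p > 0" "M > 0" "R > 0"
  shows "measure \<mu> {x. R < norm x} \<le> M / R powr p"
proof -
  interpret prob_space \<mu> using \<mu> by (simp add: P_mom_le_def prob_measures_def)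
  have s: "sets \<mu> = sets borel" using \<mu> by (auto simp: P_mom_le_def prob_measures_def)
  have meas: "{x. R < norm x} \<in> sets \<mu>" unfolding s by measurable
  have "ennreal (R powr p * measure \<mu> {x. R < norm x}) = (\<integral>\<^sup>+ x. ennreal (R powr p) * indicator {x. R < norm x} x \<partial>\<mu>)"
    using meas by (simp add: nn_integral_cmult_indicator emeasure_eq_measure ennreal_mult)
  also have "\<dots> \<le> moment \<mu> p"
    unfolding moment_def
    by (intro nn_integral_mono) (auto simp: indicator_def intro!: ennreal_leI powr_mono2 less_imp_le[OF \<open>p > 0\<close>] less_imp_le[OF \<open>R > 0\<close>])
  also have "\<dots> \<le> ennreal M" using \<mu> by (simp add: P_mom_le_def)
  finally have "R powr p * measure \<mu> {x. R < norm x} \<le> M" using \<open>M > 0\<close> by simp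
  then show ?thesis using \<open>R > 0\<close> by (simp add: pos_le_divide_eq mult.commute)
qed

text \<open>The truncated powers are bounded continuous test functions, so their integrals stay
  below \<open>M\<close> in the limit; monotone convergence in the truncation level then bounds the
  full moment.\<close>

lemma P_mom_le_weakly_closed:
  fixes \<mu>s :: "nat \<Rightarrow> 'a::euclidean_space measure"
  assumes \<mu>s: "\<And>n. \<mu>s n \<in> P_mom_le p M" and \<mu>: "\<mu> \<in> prob_measures" and wc: "weak_conv_seq \<mu>s \<mu>"
    and "p > 0" "M > 0"
  shows "\<mu> \<in> P_mom_le p M"
proof -
  define g where "g c x = min (norm x powr p) (real c)" for c :: nat and x :: 'a
  have gc: "continuous_on UNIV (g c)" for c
    unfolding g_def using \<open>p > 0\<close> by (auto intro!: continuous_intros continuous_on_powr')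
  have gb: "\<bar>g c x\<bar> \<le> real c" "0 \<le> g c x" for c x by (auto simp: g_def)
  have gi: "integrable \<rho> (g c)" if "\<rho> \<in> prob_measures" for \<rho> c
    by (rule prob_measures_integrable_continuous[OF that gc gb(1)])
  have nn: "(\<integral>\<^sup>+ x. ennreal (g c x) \<partial>\<rho>) = ennreal (\<integral>x. g c x \<partial>\<rho>)" if "\<rho> \<in> prob_measures" for \<rho> c
    by (rule nn_integral_eq_integral[OF gi[OF that]]) (simp add: gb)
  have "(\<integral>x. g c x \<partial>\<mu>s n) \<le> M" for c n
  proof -
    have "ennreal (\<integral>x. g c x \<partial>\<mu>s n) = (\<integral>\<^sup>+ x. ennreal (g c x) \<partial>\<mu>s n)"
      using nn \<mu>s by (simp add: P_mom_le_def)
    also have "\<dots> \<le> moment (\<mu>s n) p" unfolding moment_def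
      by (intro nn_integral_mono ennreal_leI) (simp add: g_def)
    also have "\<dots> \<le> ennreal M" using \<mu>s by (simp add: P_mom_le_def)
    finally show ?thesis using \<open>M > 0\<close> by simp
  qed
  moreover have "(\<lambda>n. \<integral>x. g c x \<partial>\<mu>s n) \<longlonglongrightarrow> (\<integral>x. g c x \<partial>\<mu>)" for c
    using wc gc gb(1) unfolding weak_conv_seq_def bounded_iff by force
  ultimately have "(\<integral>x. g c x \<partial>\<mu>) \<le> M" for c by (meson LIMSEQ_le_const2)
  then have le: "(\<integral>\<^sup>+ x. ennreal (g c x) \<partial>\<mu>) \<le> ennreal M" for c
    by (simp add: nn[OF \<mu>] ennreal_leI)
  have "(\<lambda>c. ennreal (g c x)) \<longlonglongrightarrow> ennreal (norm x powr p)" for x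
  proof -
    obtain m where m: "norm x powr p \<le> real m" using real_arch_simple by blast
    have "\<forall>\<^sub>F c in sequentially. ennreal (g c x) = ennreal (norm x powr p)"
      unfolding eventually_sequentially using m by (intro exI[of _ m]) (auto simp: g_def min_def)
    then show ?thesis by (rule tendsto_eventually)
  qed
  then have "(\<lambda>c. \<integral>\<^sup>+ x. ennreal (g c x) \<partial>\<mu>) \<longlonglongrightarrow> moment \<mu> p"
    unfolding moment_def
  proof (intro nn_integral_LIMSEQ)
    show "incseq (\<lambda>c x. ennreal (g c x))" by (auto simp: incseq_def le_fun_def g_def intro!: ennreal_leI)
    show "(\<lambda>x. ennreal (g c x)) \<in> borel_measurable \<mu>" for c using gi[OF \<mu>] by auto
  qed
  then have "moment \<mu> p \<le> ennreal M" using le by (intro LIMSEQ_le_const2) auto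
  then show ?thesis using \<mu> by (simp add: P_mom_le_def)
qed

section \<open>Finitely supported measures and partitions of unity\<close>

text \<open>The missing mass is placed at the origin, where it does not contribute to moments.\<close>

definition atomic_measure :: "nat \<Rightarrow> (nat \<Rightarrow> 'a::euclidean_space) \<Rightarrow> (nat \<Rightarrow> real) \<Rightarrow> 'a measure" where
  "atomic_measure N x a = distr
     (point_measure {..N} (\<lambda>i. ennreal (if i < N then a i else 1 - (\<Sum>j<N. a j)))) borel
     (\<lambda>i. if i < N then x i else 0)"

lemma atomic_measure_cong:
  assumes "\<And>i. i < N \<Longrightarrow> a i = b i"
  shows "atomic_measure N x a = atomic_measure N x b"
proof -
  have "(\<Sum>j<N. a j) = (\<Sum>j<N. b j)" using assms by simp
  then show ?thesis unfolding atomic_measure_def using assms by (simp cong: if_cong)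
qed

context
  fixes N :: nat and x :: "nat \<Rightarrow> 'a::euclidean_space" and a :: "nat \<Rightarrow> real"
  assumes a: "\<And>i. i < N \<Longrightarrow> 0 \<le> a i" "(\<Sum>i<N. a i) \<le> 1"
begin

lemma nn_integral_atomic_measure:
  assumes "f \<in> borel_measurable borel"
  shows "(\<integral>\<^sup>+ y. f y \<partial>atomic_measure N x a) =
    (\<Sum>i<N. ennreal (a i) * f (x i)) + ennreal (1 - (\<Sum>i<N. a i)) * f 0"
  unfolding atomic_measure_def using assms a
  by (subst nn_integral_distr)
    (auto simp: measurable_point_measure_eq1 nn_integral_point_measure_finite lessThan_Suc_atMost[symmetric] intro!: sum.cong)

lemma integral_atomic_measure:
  fixes f :: "'a \<Rightarrow> real"
  assumes "f \<in> borel_measurable borel"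
  shows "(\<integral>y. f y \<partial>atomic_measure N x a) = (\<Sum>i<N. a i * f (x i)) + (1 - (\<Sum>i<N. a i)) * f 0"
  unfolding atomic_measure_def using assms a
  by (subst integral_distr)
    (auto simp: measurable_point_measure_eq1 lebesgue_integral_point_measure_finite lessThan_Suc_atMost[symmetric] intro!: sum.cong)

lemma atomic_measure_in_prob_measures: "atomic_measure N x a \<in> prob_measures"
proof -
  have "0 \<le> (\<Sum>i<N. a i)" using a by (intro sum_nonneg) auto
  then have "(\<Sum>i<N. ennreal (a i)) + ennreal (1 - (\<Sum>i<N. a i)) = 1"
    using a by (subst sum_ennreal) (auto simp flip: ennreal_plus)
  then have "emeasure (atomic_measure N x a) UNIV = 1"
    using nn_integral_atomic_measure[of "\<lambda>_. 1"] by (simp add: atomic_measure_def)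
  then show ?thesis
    by (auto simp: prob_measures_def atomic_measure_def intro!: prob_spaceI)
qed

lemma moment_atomic_measure:
  "moment (atomic_measure N x a) p = ennreal (\<Sum>i<N. a i * norm (x i) powr p)"
  unfolding moment_def using a
  by (subst nn_integral_atomic_measure, simp, subst sum_ennreal[symmetric]) (auto simp: ennreal_mult intro!: sum.cong)

end

text \<open>Hat functions over a finite net of the ball are normalised. The node \<open>x i\<close>
  is not the centre of its hat but a point of least norm in the closed ball around it, so moving
  mass from \<open>y\<close> to \<open>x i\<close> never increases moments.\<close>

lemma small_partition_of_unity:
  fixes R \<epsilon> :: real
  assumes "\<epsilon> > 0"
  shows "\<exists>N (x :: nat \<Rightarrow> 'a::euclidean_space) \<phi>. (\<forall>i. continuous_on UNIV (\<phi> i :: 'a \<Rightarrow> real)) \<and>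
    (\<forall>i y. 0 \<le> \<phi> i y) \<and> (\<forall>y. (\<Sum>i<N. \<phi> i y) \<le> 1) \<and> (\<forall>y. norm y \<le> R \<longrightarrow> (\<Sum>i<N. \<phi> i y) = 1) \<and>
    (\<forall>i<N. \<forall>y. \<phi> i y > 0 \<longrightarrow> norm (x i) \<le> norm y \<and> dist (x i) y \<le> \<epsilon>)"
proof (cases "R \<ge> 0")
  case False
  have "\<not> norm y \<le> R" for y :: 'a using False norm_ge_zero[of y] by linarith
  then show ?thesis by (intro exI[of _ 0] exI[of _ "\<lambda>_. 0"] exI[of _ "\<lambda>_ _. 0"]) auto
next
  case R: True
  \<comment> \<open>Half of \<epsilon> is spent from node to centre and half from centre to
    \<open>y\<close>.\<close>
  define \<delta> where "\<delta> = \<epsilon> / 2"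
  have \<delta>: "\<delta> > 0" using assms by (simp add: \<delta>_def)
  obtain C where C: "finite C" "cball (0::'a) R \<subseteq> (\<Union>c\<in>C. ball c \<delta>)"
    using compact_cball[of "0::'a" R] \<delta> unfolding compact_eq_totally_bounded by blast
  obtain N and c :: "nat \<Rightarrow> 'a" where c: "C = c ` {..<N}"
    using finite_imp_nat_seg_image_inj_on[OF C(1)] by (auto simp: lessThan_def)
  have "\<exists>z \<in> cball (c i) \<delta>. \<forall>y\<in>cball (c i) \<delta>. norm z \<le> norm y" for i
    by (rule continuous_attains_inf) (use \<delta> in \<open>auto intro!: continuous_intros\<close>)
  then obtain x where x: "\<And>i. dist (c i) (x i) \<le> \<delta>" "\<And>i y. dist (c i) y \<le> \<delta> \<Longrightarrow> norm (x i) \<le> norm y"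
    unfolding Bex_def Ball_def mem_cball by metis
  define \<psi> where "\<psi> i y = max 0 (\<delta> - dist (c i) y)" for i y
  \<comment> \<open>The distance term keeps the denominator positive outside the ball and vanishes
    on it, where the normalised hats therefore sum to exactly 1.\<close>
  define D where "D y = (\<Sum>i<N. \<psi> i y) + infdist y (cball 0 R)" for y
  have \<psi>0: "0 \<le> \<psi> i y" for i y by (simp add: \<psi>_def)
  have D0: "D y > 0" for y
  proof (cases "norm y \<le> R")
    case True
    then have "y \<in> cball 0 R" by simp
    then obtain i where i: "i < N" "dist (c i) y < \<delta>" using C(2) unfolding c by auto
    then have "0 < (\<Sum>i<N. \<psi> i y)" using \<psi>0 by (intro sum_pos2[of _ i]) (auto simp: \<psi>_def)
    then show ?thesis by (simp add: D_def infdist_nonneg add_pos_nonneg)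
  next
    case False
    then have "y \<notin> cball 0 R" "cball (0::'a) R \<noteq> {}" using R by auto
    then have "infdist y (cball 0 R) > 0"
      using in_closed_iff_infdist_zero[OF closed_cball, of 0 R y] infdist_nonneg[of y "cball 0 R"] by linarith
    then show ?thesis by (simp add: D_def sum_nonneg \<psi>0 add_nonneg_pos)
  qed
  define \<phi> where "\<phi> i y = \<psi> i y / D y" for i y
  have sum: "(\<Sum>i<N. \<phi> i y) = (D y - infdist y (cball 0 R)) / D y" for y
    by (simp add: \<phi>_def D_def flip: sum_divide_distrib)
  have "continuous_on UNIV (\<phi> i)" for i
    unfolding \<phi>_def \<psi>_def using D0[unfolded D_def \<psi>_def]
    by (intro continuous_intros) (auto simp: D_def \<psi>_def less_imp_neq[symmetric] intro!: continuous_intros)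
  moreover have "0 \<le> \<phi> i y" for i y using \<psi>0 D0 by (simp add: \<phi>_def less_imp_le)
  moreover have "(\<Sum>i<N. \<phi> i y) \<le> 1" for y
    unfolding sum using D0[of y] infdist_nonneg[of y "cball 0 R"] by simp
  moreover have "(\<Sum>i<N. \<phi> i y) = 1" if "norm y \<le> R" for y
    unfolding sum using D0[of y] that by simp
  moreover have "norm (x i) \<le> norm y \<and> dist (x i) y \<le> \<epsilon>" if "\<phi> i y > 0" for i y
  proof -
    have "\<psi> i y > 0" using that D0[of y] by (simp add: \<phi>_def zero_less_divide_iff)
    then have d: "dist (c i) y \<le> \<delta>" by (simp add: \<psi>_def)
    have "dist (x i) y \<le> dist (c i) (x i) + dist (c i) y" by (metis dist_commute dist_triangle)
    then show ?thesis using x(1)[of i] x(2)[OF d] d by (simp add: \<delta>_def)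
  qed
  ultimately show ?thesis by (intro exI[of _ N] exI[of _ x] exI[of _ \<phi>]) blast
qed

section \<open>Schauder's argument\<close>

lemma P_mom_le_weakly_compact:
  fixes \<mu>s :: "nat \<Rightarrow> 'a::euclidean_space measure"
  assumes \<mu>s: "\<And>n. \<mu>s n \<in> P_mom_le p M" and "p > 0" "M > 0"
  shows "\<exists>r \<mu>. strict_mono (r :: nat \<Rightarrow> nat) \<and> \<mu> \<in> P_mom_le p M \<and> weak_conv_seq (\<mu>s \<circ> r) \<mu>"
proof -
  have "\<exists>R. \<forall>n. measure (\<mu>s n) {x. R < norm x} < \<epsilon>" if "\<epsilon> > 0" for \<epsilon> :: real
  proof -
    \<comment> \<open>Chosen so that the Markov bound \<open>M / R powr p\<close> equals half of
      \<epsilon>.\<close>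
    define R where "R = (2 * M / \<epsilon>) powr (1 / p)"
    have "R > 0" "R powr p = 2 * M / \<epsilon>"
      using assms(2,3) that by (auto simp: R_def powr_powr)
    then have half: "measure (\<mu>s n) {x. R < norm x} \<le> \<epsilon> / 2" for n
      using P_mom_le_tail[OF \<mu>s assms(2,3), of R n] \<open>M > 0\<close> by simp
    have "measure (\<mu>s n) {x. R < norm x} < \<epsilon>" for n
      using half[of n] that by linarith
    then show ?thesis by blast
  qed
  then obtain r \<mu> where r: "strict_mono (r :: nat \<Rightarrow> nat)" "\<mu> \<in> prob_measures" "weak_conv_seq (\<mu>s \<circ> r) \<mu>"
    using tight_imp_weakly_convergent_subsequence[of \<mu>s] \<mu>s by (auto simp: P_mom_le_def)
  moreover have "\<mu> \<in> P_mom_le p M"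
    by (rule P_mom_le_weakly_closed[OF _ r(2,3) assms(2,3)]) (simp add: \<mu>s)
  ultimately show ?thesis by blast
qed

text \<open>Brouwer's theorem for the weights of atomic measures. The map \<open>\<mu> \<mapsto> \<Sum>\<^sub>i \<mu>(\<phi>\<^sub>i) \<delta>\<^sub>x\<^sub>i\<close>
  does not increase the moment since \<open>|x\<^sub>i| \<le> |y|\<close> on the support of \<open>\<phi>\<^sub>i\<close>, and
  \<open>clip\<close> retracts the cube onto the admissible weights.\<close>

lemma approximate_fixed_point:
  fixes T :: "'a::euclidean_space measure \<Rightarrow> 'a measure"
  assumes T: "\<And>\<mu>. \<mu> \<in> P_mom_le p M \<Longrightarrow> T \<mu> \<in> P_mom_le p M"
    and cont: "\<And>\<mu>s \<mu>. (\<And>n. \<mu>s n \<in> P_mom_le p M) \<Longrightarrow> \<mu> \<in> P_mom_le p M \<Longrightarrow> weak_conv_seq \<mu>s \<mu>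
      \<Longrightarrow> weak_conv_seq (\<lambda>n. T (\<mu>s n)) (T \<mu>)"
    and "p > 0" "M > 0" "\<epsilon> > 0"
  shows "\<exists>\<mu>\<in>P_mom_le p M. \<forall>f B \<eta>. continuous_on UNIV f \<longrightarrow> (\<forall>x. \<bar>f x\<bar> \<le> B) \<longrightarrow> 0 \<le> \<eta> \<longrightarrow>
    (\<forall>x y. dist x y \<le> \<epsilon> \<longrightarrow> \<bar>f x - f y\<bar> \<le> \<eta>) \<longrightarrow>
    \<bar>(\<integral>x. f x \<partial>\<mu>) - (\<integral>x. f x \<partial>T \<mu>)\<bar> \<le> \<eta> + 2 * B * measure (T \<mu>) {x. R < norm x}"
proof -
  obtain N and x :: "nat \<Rightarrow> 'a" and \<phi> :: "nat \<Rightarrow> 'a \<Rightarrow> real"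
    where \<phi>c: "\<And>i. continuous_on UNIV (\<phi> i)" and \<phi>0: "\<And>i y. 0 \<le> \<phi> i y"
      and \<phi>le: "\<And>y. (\<Sum>i<N. \<phi> i y) \<le> 1" and \<phi>1: "\<And>y. norm y \<le> R \<Longrightarrow> (\<Sum>i<N. \<phi> i y) = 1"
      and near: "\<And>i y. i < N \<Longrightarrow> \<phi> i y > 0 \<Longrightarrow> norm (x i) \<le> norm y \<and> dist (x i) y \<le> \<epsilon>"
    using small_partition_of_unity[OF \<open>\<epsilon> > 0\<close>, of R] by metis
  have \<phi>b: "\<phi> i y \<le> 1" if "i < N" for i y
    using member_le_sum[of i "{..<N}" "\<lambda>i. \<phi> i y"] \<phi>0 \<phi>le[of y] that by simp
  define S where "S a = (\<Sum>i<N. a i)" for a :: "nat \<Rightarrow> real"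
  define m where "m a = (\<Sum>i<N. a i * norm (x i) powr p)" for a :: "nat \<Rightarrow> real"
  \<comment> \<open>For nonnegative weights this is the least divisor, at least 1, that brings the
    mass below 1 and the moment below \<open>M\<close>. Admissible weights have
    \<open>s a = 1\<close> and are left alone by \<open>clip\<close>.\<close>
  define s where "s a = max 1 (max (S a) (m a / M))" for a
  define clip where "clip a = (\<lambda>i. a i / s a)" for a
  have s1: "s a \<ge> 1" for a by (simp add: s_def)
  have s0: "s a > 0" for a using s1[of a] by linarith
  have mK: "atomic_measure N x a \<in> P_mom_le p M" if "\<And>i. i < N \<Longrightarrow> 0 \<le> a i" "S a \<le> 1" "m a \<le> M" for a
    using atomic_measure_in_prob_measures[of N a x] moment_atomic_measure[of N a x p] that
    by (auto simp: P_mom_le_def S_def m_def intro!: ennreal_leI)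
  have clipS: "S (clip a) = S a / s a" "m (clip a) = m a / s a" for a
    by (simp_all add: S_def m_def clip_def sum_divide_distrib)
  have clip: "0 \<le> clip a i" "S (clip a) \<le> 1" "m (clip a) \<le> M"
    if "\<And>i. i < N \<Longrightarrow> 0 \<le> a i" "i < N" for a i
  proof -
    show "0 \<le> clip a i" using that s0[of a] by (simp add: clip_def)
    have "S a \<le> s a" "m a / M \<le> s a" by (auto simp: s_def)
    then show "S (clip a) \<le> 1" "m (clip a) \<le> M"
      unfolding clipS using s0[of a] \<open>M > 0\<close> by (simp_all add: field_simps)
  qed
  define \<rho> where "\<rho> a = T (atomic_measure N x (clip a))" for a
  have \<rho>K: "\<rho> a \<in> P_mom_le p M" if "\<And>i. i < N \<Longrightarrow> 0 \<le> a i" for a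
  \<comment> \<open>The fact \<open>clip\<close> presupposes an index below \<open>N\<close>, so the
    case without nodes, where the measure is the point mass at the origin, is separate.\<close>
  proof (cases "N = 0")
    case True
    then show ?thesis unfolding \<rho>_def using \<open>M > 0\<close> by (intro T mK) (auto simp: S_def m_def)
  next
    case False
    then show ?thesis unfolding \<rho>_def using clip[of a] that by (intro T mK) (auto simp: gr0_conv_Suc)
  qed
  have \<rho>P: "\<rho> a \<in> prob_measures" if "\<And>i. i < N \<Longrightarrow> 0 \<le> a i" for a
    using \<rho>K[OF that] by (simp add: P_mom_le_def)
  have \<phi>int: "integrable \<mu> (\<phi> i)" if "\<mu> \<in> prob_measures" "i < N" for \<mu> i
    by (rule prob_measures_integrable_continuous[OF that(1) \<phi>c, of _ 1]) (use \<phi>0 \<phi>b that in auto)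
  \<comment> \<open>Brouwer is applied to the map from weights to the integrals of the
    \<open>\<phi> i\<close> against \<open>\<rho> a\<close>. Convergent clipped weights give weakly
    convergent atomic measures, and \<open>T\<close> preserves this convergence.\<close>
  have "\<exists>a. (\<forall>i<N. a i \<in> {0..1}) \<and> (\<forall>i<N. (\<integral>y. \<phi> i y \<partial>\<rho> a) = a i)"
  proof (rule brouwer_unit_cube_sequences)
    fix a i assume a: "\<And>j. j < N \<Longrightarrow> a j \<in> {0..1::real}" and i: "i < N"
    have P: "\<rho> a \<in> prob_measures" using a by (intro \<rho>P) auto
    then interpret prob_space "\<rho> a" by (simp add: prob_measures_def)
    have "(\<integral>y. \<phi> i y \<partial>\<rho> a) \<le> 1"
      by (rule integral_le_const[OF \<phi>int[OF P i]]) (use \<phi>b i in auto)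
    then show "(\<integral>y. \<phi> i y \<partial>\<rho> a) \<in> {0..1}" using \<phi>0 by simp
  next
    fix A a i assume A: "\<And>k j. j < N \<Longrightarrow> A k j \<in> {0..1::real}"
      and lim: "\<And>j. j < N \<Longrightarrow> (\<lambda>k. A k j) \<longlonglongrightarrow> a j" and i: "i < N"
    have a: "0 \<le> a j" if "j < N" for j
      by (rule LIMSEQ_le_const[OF lim[OF that]]) (use A that in auto)
    have "(\<lambda>k. s (A k)) \<longlonglongrightarrow> s a"
      unfolding s_def S_def m_def using \<open>M > 0\<close> by (intro tendsto_intros lim) auto
    then have cl: "(\<lambda>k. clip (A k) j) \<longlonglongrightarrow> clip a j" if "j < N" for j
      unfolding clip_def using s0[of a] that by (intro tendsto_divide lim) auto
    have K: "clip b \<in> {c. (\<forall>j<N. 0 \<le> c j) \<and> S c \<le> 1 \<and> m c \<le> M}" if "\<And>j. j < N \<Longrightarrow> 0 \<le> b j" for b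
      using clip[OF that] i by auto
    have int: "(\<integral>y. f y \<partial>atomic_measure N x (clip b)) =
        (\<Sum>i<N. clip b i * f (x i)) + (1 - (\<Sum>i<N. clip b i)) * f 0"
      if "continuous_on UNIV f" "\<And>j. j < N \<Longrightarrow> 0 \<le> b j" for f :: "'a \<Rightarrow> real" and b
      using K[OF that(2)] borel_measurable_continuous_onI[OF that(1)]
      by (intro integral_atomic_measure) (auto simp: S_def)
    have "weak_conv_seq (\<lambda>k. atomic_measure N x (clip (A k))) (atomic_measure N x (clip a))"
      unfolding weak_conv_seq_def
    proof (intro allI impI, elim conjE)
      fix f :: "'a \<Rightarrow> real" assume f: "continuous_on UNIV f"
      have "(\<lambda>k. (\<Sum>i<N. clip (A k) i * f (x i)) + (1 - (\<Sum>i<N. clip (A k) i)) * f 0)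
        \<longlonglongrightarrow> (\<Sum>i<N. clip a i * f (x i)) + (1 - (\<Sum>i<N. clip a i)) * f 0"
        by (intro tendsto_intros cl) auto
      then show "(\<lambda>k. \<integral>y. f y \<partial>atomic_measure N x (clip (A k))) \<longlonglongrightarrow> (\<integral>y. f y \<partial>atomic_measure N x (clip a))"
        using A a by (simp add: int[OF f])
    qed
    then have "weak_conv_seq (\<lambda>k. \<rho> (A k)) (\<rho> a)"
      unfolding \<rho>_def using A a K by (intro cont mK) auto
    moreover have "bounded (range (\<phi> i))"
      unfolding bounded_iff using \<phi>0 \<phi>b[OF i] by (intro exI[of _ 1]) auto
    ultimately show "(\<lambda>k. \<integral>y. \<phi> i y \<partial>\<rho> (A k)) \<longlonglongrightarrow> (\<integral>y. \<phi> i y \<partial>\<rho> a)"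
      using \<phi>c unfolding weak_conv_seq_def by blast
  qed
  then obtain a where a01: "\<And>i. i < N \<Longrightarrow> a i \<in> {0..1}" and afix: "\<And>i. i < N \<Longrightarrow> (\<integral>y. \<phi> i y \<partial>\<rho> a) = a i"
    by blast
  have a0: "0 \<le> a i" if "i < N" for i using a01[OF that] by simp
  define \<mu> where "\<mu> = atomic_measure N x a"
  have K: "\<rho> a \<in> P_mom_le p M" and P: "\<rho> a \<in> prob_measures" using \<rho>K \<rho>P a0 by auto
  interpret prob_space "\<rho> a" using P by (simp add: prob_measures_def)
  have sets_\<rho>: "sets (\<rho> a) = sets borel" using P by (simp add: prob_measures_def)
  \<comment> \<open>At the fixed point, linear functionals of the weights are integrals against
    \<open>\<rho> a\<close>. The mass and moment bounds of \<open>\<rho> a\<close> thus pass to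
    \<open>a\<close>, so that \<open>clip\<close> is inactive there and \<open>T \<mu>\<close> is
    \<open>\<rho> a\<close> itself.\<close>
  have sum_fix: "(\<Sum>i<N. a i * c i) = (\<integral>y. (\<Sum>i<N. \<phi> i y * c i) \<partial>\<rho> a)" for c :: "nat \<Rightarrow> real"
    using \<phi>int[OF P] by (subst Bochner_Integration.integral_sum) (auto simp: afix)
  have sum_int: "integrable (\<rho> a) (\<lambda>y. \<Sum>i<N. \<phi> i y * c i)" for c :: "nat \<Rightarrow> real"
    using \<phi>int[OF P] by (intro Bochner_Integration.integrable_sum) auto
  have "S a \<le> 1"
    using sum_fix[of "\<lambda>_. 1"] integral_le_const[OF sum_int[of "\<lambda>_. 1"], of 1] \<phi>le by (simp add: S_def)
  moreover have "m a \<le> M"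
  proof -
    have le: "(\<Sum>i<N. \<phi> i y * norm (x i) powr p) \<le> norm y powr p" for y
    proof -
      have "(\<Sum>i<N. \<phi> i y * norm (x i) powr p) \<le> (\<Sum>i<N. \<phi> i y * norm y powr p)"
      proof (intro sum_mono)
        fix i assume "i \<in> {..<N}"
        then show "\<phi> i y * norm (x i) powr p \<le> \<phi> i y * norm y powr p"
          using near[of i y] \<phi>0[of i y] \<open>p > 0\<close>
          by (cases "\<phi> i y = 0") (auto intro!: mult_left_mono powr_mono2)
      qed
      also have "\<dots> \<le> 1 * norm y powr p"
        unfolding sum_distrib_right[symmetric] by (intro mult_right_mono \<phi>le) simp
      finally show ?thesis by simp
    qed
    have "ennreal (m a) = (\<integral>\<^sup>+ y. ennreal (\<Sum>i<N. \<phi> i y * norm (x i) powr p) \<partial>\<rho> a)"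
      unfolding m_def sum_fix using \<phi>0 by (intro nn_integral_eq_integral[symmetric] sum_int) (auto intro!: sum_nonneg)
    also have "\<dots> \<le> moment (\<rho> a) p"
      unfolding moment_def using le by (intro nn_integral_mono ennreal_leI)
    also have "\<dots> \<le> ennreal M" using K by (simp add: P_mom_le_def)
    finally show ?thesis using \<open>M > 0\<close> by simp
  qed
  ultimately have "s a = 1" using \<open>M > 0\<close> by (auto simp: s_def max_def)
  then have T\<mu>: "T \<mu> = \<rho> a" by (simp add: \<rho>_def \<mu>_def clip_def)
  have "\<mu> \<in> P_mom_le p M" unfolding \<mu>_def by (rule mK) fact+
  moreover have "\<bar>(\<integral>x. f x \<partial>\<mu>) - (\<integral>x. f x \<partial>T \<mu>)\<bar> \<le> \<eta> + 2 * B * measure (T \<mu>) {x. R < norm x}"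
    if f: "continuous_on UNIV f" "\<forall>x. \<bar>f x\<bar> \<le> B" "0 \<le> \<eta>" and fe: "\<forall>x y. dist x y \<le> \<epsilon> \<longrightarrow> \<bar>f x - f y\<bar> \<le> \<eta>"
    for f B \<eta>
  proof -
    \<comment> \<open>\<open>h y\<close> integrates \<open>f\<close> against the atomic measure with
      weights \<open>\<phi> i y\<close>; averaging over \<open>\<rho> a\<close> yields the integral
      against \<mu>. The factor 1 lets \<open>sum_fix\<close> rewrite the mass term as well.\<close>
    define h where "h y = (\<Sum>i<N. \<phi> i y * f (x i)) + (1 - (\<Sum>i<N. \<phi> i y * 1)) * f 0" for y
    have hi: "integrable (\<rho> a) h" unfolding h_def
      by (intro Bochner_Integration.integrable_add integrable_mult_left Bochner_Integration.integrable_diff sum_int) simp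
    have fi: "integrable (\<rho> a) f" using prob_measures_integrable_continuous[OF P f(1)] f(2) by blast
    have meas: "{x. R < norm x} \<in> sets (\<rho> a)" unfolding sets_\<rho> by measurable
    have "(\<integral>x. f x \<partial>\<mu>) = (\<Sum>i<N. a i * f (x i)) + (1 - (\<Sum>i<N. a i * 1)) * f 0"
      unfolding \<mu>_def using a0 \<open>S a \<le> 1\<close> borel_measurable_continuous_onI[OF f(1)]
      by (subst integral_atomic_measure) (auto simp: S_def)
    also have "\<dots> = (\<integral>y. h y \<partial>\<rho> a)"
      unfolding sum_fix h_def using sum_int[of "\<lambda>i. f (x i)"] sum_int[of "\<lambda>_. 1"]
      by (simp add: prob_space)
    finally have "\<bar>(\<integral>x. f x \<partial>\<mu>) - (\<integral>x. f x \<partial>T \<mu>)\<bar> = \<bar>\<integral>y. h y - f y \<partial>\<rho> a\<bar>"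
      unfolding T\<mu> using hi fi by simp
    also have "\<dots> \<le> (\<integral>y. \<bar>h y - f y\<bar> \<partial>\<rho> a)" by (rule integral_abs_bound)
    also have "\<dots> \<le> (\<integral>y. \<eta> + 2 * B * indicator {x. R < norm x} y \<partial>\<rho> a)"
    proof (intro integral_mono)
      show "integrable (\<rho> a) (\<lambda>y. \<eta> + 2 * B * indicator {x. R < norm x} y)"
        using meas by (auto simp: emeasure_eq_measure)
      fix y
      \<comment> \<open>Nodes carrying weight are within \<epsilon> of \<open>y\<close> and cost at
        most \<eta>. The weight sent to the origin costs at most \<open>2 * B\<close> and is present
        only if \<open>R < norm y\<close>.\<close>
      have "h y - f y = (\<Sum>i<N. \<phi> i y * (f (x i) - f y)) + (1 - (\<Sum>i<N. \<phi> i y)) * (f 0 - f y)"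
        by (simp add: h_def algebra_simps sum_subtractf sum_distrib_left sum_distrib_right)
      also have "\<bar>\<dots>\<bar> \<le> (\<Sum>i<N. \<phi> i y * \<eta>) + (1 - (\<Sum>i<N. \<phi> i y)) * (2 * B)"
      proof (intro order_trans[OF abs_triangle_ineq] add_mono)
        have "\<bar>\<phi> i y * (f (x i) - f y)\<bar> \<le> \<phi> i y * \<eta>" if "i < N" for i
          using near[OF that, of y] \<phi>0[of i y] fe
          by (cases "\<phi> i y = 0") (auto simp: abs_mult intro!: mult_left_mono)
        then show "\<bar>\<Sum>i<N. \<phi> i y * (f (x i) - f y)\<bar> \<le> (\<Sum>i<N. \<phi> i y * \<eta>)"
          by (intro order_trans[OF sum_abs] sum_mono) auto
        have "\<bar>f 0 - f y\<bar> \<le> 2 * B" using f(2)[rule_format, of 0] f(2)[rule_format, of y] by linarith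
        then show "\<bar>(1 - (\<Sum>i<N. \<phi> i y)) * (f 0 - f y)\<bar> \<le> (1 - (\<Sum>i<N. \<phi> i y)) * (2 * B)"
          using \<phi>le[of y] by (simp add: abs_mult mult_left_mono)
      qed
      also have "(\<Sum>i<N. \<phi> i y * \<eta>) \<le> 1 * \<eta>"
        unfolding sum_distrib_right[symmetric] by (intro mult_right_mono \<phi>le f)
      also have "(1 - (\<Sum>i<N. \<phi> i y)) * (2 * B) \<le> 2 * B * indicator {x. R < norm x} y"
      proof (cases "R < norm y")
        case True
        have "0 \<le> (\<Sum>i<N. \<phi> i y)" by (intro sum_nonneg \<phi>0)
        moreover have "0 \<le> B" using f(2) abs_ge_zero order_trans by blast
        ultimately show ?thesis using True mult_right_mono[of "1 - (\<Sum>i<N. \<phi> i y)" 1 B] by simp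
      qed (simp add: \<phi>1)
      finally show "\<bar>h y - f y\<bar> \<le> \<eta> + 2 * B * indicator {x. R < norm x} y" by simp
    qed (intro integrable_abs Bochner_Integration.integrable_diff hi fi)
    also have "\<dots> = \<eta> + 2 * B * measure (T \<mu>) {x. R < norm x}"
      unfolding T\<mu> using meas by (subst Bochner_Integration.integral_add) (auto simp: emeasure_eq_measure prob_space[unfolded prob_measures_space[OF P]] prob_measures_space[OF P])
    finally show ?thesis .
  qed
  ultimately show ?thesis by (intro bexI[of _ \<mu>]) blast+
qed

text \<open>Approximate fixed points at scale \<open>1 / Suc n\<close> and radius
  \<open>Suc n\<close> have a weakly convergent subsequence. By continuity of \<open>T\<close> their
  images converge too, and since the defect vanishes for every bounded Lipschitz function, the limit
  and its image coincide.\<close>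

lemma weakly_continuous_fixed_point:
  fixes T :: "'a::euclidean_space measure \<Rightarrow> 'a measure"
  assumes T: "\<And>\<mu>. \<mu> \<in> P_mom_le p M \<Longrightarrow> T \<mu> \<in> P_mom_le p M"
    and cont: "\<And>\<mu>s \<mu>. (\<And>n. \<mu>s n \<in> P_mom_le p M) \<Longrightarrow> \<mu> \<in> P_mom_le p M \<Longrightarrow> weak_conv_seq \<mu>s \<mu>
      \<Longrightarrow> weak_conv_seq (\<lambda>n. T (\<mu>s n)) (T \<mu>)"
    and p: "p > 0" and M: "M > 0"
  shows "\<exists>\<mu>\<in>P_mom_le p M. T \<mu> = \<mu>"
proof -
  define Q where "Q n \<mu> \<longleftrightarrow> (\<forall>f B \<eta>. continuous_on UNIV f \<longrightarrow> (\<forall>x. \<bar>f x\<bar> \<le> B) \<longrightarrow> 0 \<le> \<eta> \<longrightarrow>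
    (\<forall>x y. dist x y \<le> 1 / Suc n \<longrightarrow> \<bar>f x - f y\<bar> \<le> \<eta>) \<longrightarrow>
    \<bar>(\<integral>x. f x \<partial>\<mu>) - (\<integral>x. f x \<partial>T \<mu>)\<bar> \<le> \<eta> + 2 * B * measure (T \<mu>) {x. real (Suc n) < norm x})" for n \<mu>
  have "\<exists>\<mu>\<in>P_mom_le p M. Q n \<mu>" for n
    unfolding Q_def by (rule approximate_fixed_point[OF _ _ p M]) (simp_all add: T cont)
  then obtain \<mu>s where \<mu>s: "\<And>n. \<mu>s n \<in> P_mom_le p M" and Q: "\<And>n. Q n (\<mu>s n)"
    by metis
  obtain r \<mu> where r: "strict_mono (r :: nat \<Rightarrow> nat)" and \<mu>: "\<mu> \<in> P_mom_le p M" and wc: "weak_conv_seq (\<mu>s \<circ> r) \<mu>"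
    using P_mom_le_weakly_compact[of \<mu>s, OF \<mu>s p M] by (elim exE conjE) (rule that)
  have wcT: "weak_conv_seq (\<lambda>n. T ((\<mu>s \<circ> r) n)) (T \<mu>)"
    by (rule cont[OF _ \<mu> wc]) (simp add: \<mu>s)
  have "T \<mu> = \<mu>"
  proof (rule sym, rule prob_measures_eqI_bounded_lipschitz)
    fix f :: "'a \<Rightarrow> real" and L B
    assume lip: "\<And>x y. \<bar>f x - f y\<bar> \<le> L * dist x y" and B: "\<And>x. \<bar>f x\<bar> \<le> B" and L: "L \<ge> 0"
    have "L-lipschitz_on UNIV f" using lip L by (auto simp: lipschitz_on_def dist_real_def)
    then have fc: "continuous_on UNIV f" by (rule lipschitz_on_continuous_on)
    have B0: "0 \<le> B" using B[of 0] by linarith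
    \<comment> \<open>The Lipschitz constant supplies \<open>\<eta> = L / Suc n\<close>, and
      Markov's inequality bounds the tail of \<open>T (\<mu>s n)\<close>, uniformly because
      \<open>T\<close> maps into \<open>P_mom_le p M\<close>.\<close>
    have bound: "\<bar>(\<integral>x. f x \<partial>\<mu>s n) - (\<integral>x. f x \<partial>T (\<mu>s n))\<bar> \<le> L * (1 / real (Suc n)) + 2 * B * (M * real (Suc n) powr (- p))" for n
    proof -
      have "\<bar>(\<integral>x. f x \<partial>\<mu>s n) - (\<integral>x. f x \<partial>T (\<mu>s n))\<bar> \<le> L * (1 / real (Suc n)) + 2 * B * measure (T (\<mu>s n)) {x. real (Suc n) < norm x}"
      proof (rule Q[unfolded Q_def, rule_format, OF fc B])
        fix x y :: 'a assume "dist x y \<le> 1 / real (Suc n)"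
        then show "\<bar>f x - f y\<bar> \<le> L * (1 / real (Suc n))" using lip[of x y] L by (meson mult_left_mono order_trans)
      qed (use L in simp)
      also have "\<dots> \<le> L * (1 / real (Suc n)) + 2 * B * (M * real (Suc n) powr (- p))"
        using P_mom_le_tail[OF T[OF \<mu>s] p M, of "real (Suc n)" n] B0
        by (intro add_left_mono mult_left_mono) (auto simp: powr_minus_divide)
      finally show ?thesis .
    qed
    have "(\<lambda>n. (\<integral>x. f x \<partial>\<mu>s n) - (\<integral>x. f x \<partial>T (\<mu>s n))) \<longlonglongrightarrow> 0"
    proof (rule Lim_null_comparison)
      have "filterlim (\<lambda>n. real (Suc n)) at_top sequentially"
        using filterlim_real_sequentially by (subst filterlim_sequentially_Suc)
      then have "(\<lambda>n. real (Suc n) powr (- p)) \<longlonglongrightarrow> 0" using p by (intro tendsto_neg_powr) auto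
      moreover have "(\<lambda>n. 1 / real (Suc n)) \<longlonglongrightarrow> 0" using LIMSEQ_inverse_real_of_nat by (simp add: inverse_eq_divide)
      ultimately have "(\<lambda>n. L * (1 / real (Suc n)) + 2 * B * (M * real (Suc n) powr (- p))) \<longlonglongrightarrow> L * 0 + 2 * B * (M * 0)"
        by (intro tendsto_intros)
      then show "(\<lambda>n. L * (1 / real (Suc n)) + 2 * B * (M * real (Suc n) powr (- p))) \<longlonglongrightarrow> 0" by simp
    qed (use bound in simp)
    from LIMSEQ_subseq_LIMSEQ[OF this r]
    have "(\<lambda>n. (\<integral>x. f x \<partial>\<mu>s (r n)) - (\<integral>x. f x \<partial>T (\<mu>s (r n)))) \<longlonglongrightarrow> 0" by (simp add: o_def)
    moreover have "(\<lambda>n. (\<integral>x. f x \<partial>\<mu>s (r n)) - (\<integral>x. f x \<partial>T (\<mu>s (r n)))) \<longlonglongrightarrow> (\<integral>x. f x \<partial>\<mu>) - (\<integral>x. f x \<partial>T \<mu>)"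
      using wc wcT fc B unfolding weak_conv_seq_def bounded_iff
      by (intro tendsto_diff) (force simp: o_def)+
    ultimately show "(\<integral>x. f x \<partial>\<mu>) = (\<integral>x. f x \<partial>T \<mu>)" using LIMSEQ_unique by fastforce
  qed (use \<mu> T[OF \<mu>] in \<open>auto simp: P_mom_le_def\<close>)
  then show ?thesis using \<mu> by blast
qed

section \<open>Stationarity of fixed points\<close>

lemma frozen_fixed_point_stationary:
  fixes \<nu> :: "'a::euclidean_space measure" and W :: "'w itself"
  assumes wp: "mv_strongly_well_posed \<nu> b W" and ex: "lin_strong_existence \<nu> b \<pi> W"
    and ipm: "lin_ipm \<nu> b \<pi> W \<pi>"
  shows "mv_stationary \<nu> b W \<pi>"
  unfolding mv_stationary_def
proof (intro conjI allI impI, goal_cases)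
  case 1
  show ?case using ipm by (simp add: lin_ipm_def)
next
  case (2 M F Z X t)
  then have drv: "driving_setup M F \<nu> Z" and X: "mv_solution M F Z b X"
    and X0: "distr M borel (X 0) = \<pi>" and t: "0 \<le> t" by auto
  have sub: "subalgebra M (F t)" if "t \<ge> 0" for t
    using drv that by (auto simp: driving_setup_def filtr_def)
  have X_meas: "X t \<in> F t \<rightarrow>\<^sub>M borel" if "t \<ge> 0" for t
    using X that by (simp add: mv_solution_def sde_solution_def)
  obtain Y where Y: "lin_solution M F Z b \<pi> Y" and Y0: "\<forall>\<omega>\<in>space M. Y 0 \<omega> = X 0 \<omega>"
    using ex drv X_meas[of 0] unfolding lin_strong_existence_def by blast
  have Y_meas: "Y t \<in> F t \<rightarrow>\<^sub>M borel" if "t \<ge> 0" for t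
    using Y that by (simp add: lin_solution_def sde_solution_def)
  have "distr M borel (Y 0) = \<pi>"
    unfolding X0[symmetric] by (rule distr_cong) (use Y0 in auto)
  then have law: "distr M borel (Y s) = \<pi>" if "s \<ge> 0" for s
    using ipm drv Y that unfolding lin_ipm_def by blast
  \<comment> \<open>All laws of \<open>Y\<close> equal \<pi>, so the two drift integrands agree at
    every time in \<open>{0..u}\<close>.\<close>
  have "mv_solution M F Z b Y"
  proof -
    have "set_integrable lborel {0..u} (\<lambda>s. b (Y s \<omega>) (distr M borel (Y s))) \<longleftrightarrow>
        set_integrable lborel {0..u} (\<lambda>s. b (Y s \<omega>) \<pi>)" for u \<omega>
      by (rule set_integrable_cong) (auto simp: law)
    moreover have "(LINT s:{0..u}|lborel. b (Y s \<omega>) (distr M borel (Y s))) =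
        (LINT s:{0..u}|lborel. b (Y s \<omega>) \<pi>)" for u \<omega>
      by (rule set_lebesgue_integral_cong) (auto simp: law)
    ultimately show ?thesis
      using Y by (simp add: mv_solution_def lin_solution_def sde_solution_def)
  qed
  moreover have "AE \<omega> in M. X 0 \<omega> = Y 0 \<omega>" using Y0 by (intro AE_I2) simp
  ultimately have "AE \<omega> in M. \<forall>t\<ge>0. X t \<omega> = Y t \<omega>"
    using wp drv X unfolding mv_strongly_well_posed_def by blast
  then have "AE \<omega> in M. X t \<omega> = Y t \<omega>" using t by auto
  then have "distr M borel (X t) = distr M borel (Y t)"
    using measurable_from_subalg[OF sub X_meas] measurable_from_subalg[OF sub Y_meas] t
    by (intro distr_cong_AE) auto
  then show ?case using law[OF t] by simp
qed

theorem theorem1p1: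
  fixes \<nu> :: "'a::euclidean_space measure"
    and b :: "'a \<Rightarrow> 'a measure \<Rightarrow> 'a"
    and W :: "'w itself"
    and \<beta>s \<beta> lam1 lam2 Cb \<theta>1 \<theta>2 \<theta>3 \<theta>4 :: real
  assumes levy: "levy_measure \<nu> \<beta>s" and \<beta>s: "0 < \<beta>s" "\<beta>s \<le> 2"
    and wp: "mv_strongly_well_posed \<nu> b W"
    \<comment> \<open>(A1)\<close>
    and \<beta>: "0 < \<beta>" "\<beta> \<le> \<beta>s"
    and pos: "lam1 > 0" "lam2 > 0" "Cb > 0" "\<theta>1 > 0" "\<theta>3 > 0" "\<theta>4 > 0" "\<theta>2 \<ge> 0"
    and \<theta>1: "\<theta>1 \<ge> 1 - \<beta> / 2"
    and \<theta>2: "\<theta>2 < 1 + \<theta>1"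
    and \<theta>3: "\<theta>3 \<le> \<beta> + \<theta>1 - 1"
    and cases: "let \<beta>' = \<beta> + \<theta>1 - 1; \<gamma>1 = max (\<beta> + \<theta>2 - 2) 0 / \<beta>' in
                  \<beta>' * (1 - \<gamma>1) > \<theta>3 * \<theta>4 \<or> (\<beta>' * (1 - \<gamma>1) = \<theta>3 * \<theta>4 \<and> lam1 > lam2)"
    and drift: "\<And>x \<mu>. \<mu> \<in> P_mom (\<beta> + \<theta>1 - 1) \<Longrightarrow>
                  x \<bullet> b x \<mu> \<le> Cb - lam1 * norm x powr (1 + \<theta>1)
                     + lam2 * (1 + (norm x)\<^sup>2) powr (\<theta>2 / 2) * (\<integral>y. norm y powr \<theta>3 \<partial>\<mu>) powr \<theta>4"
    \<comment> \<open>(A2)\<close>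
    and A2: "\<And>\<mu>. \<mu> \<in> P_mom (\<beta> + \<theta>1 - 1) \<Longrightarrow>
               lin_strong_existence \<nu> b \<mu> W \<and> lin_Cb_Feller \<nu> b \<mu> W \<and> (\<exists>!\<pi>. lin_ipm \<nu> b \<mu> W \<pi>)"
    \<comment> \<open>(A3)\<close>
    and A3: "\<exists>Mstar>0.
               (\<forall>\<mu>\<in>P_mom_le (\<beta> + \<theta>1 - 1) Mstar. ipm_of \<nu> b W \<mu> \<in> P_mom_le (\<beta> + \<theta>1 - 1) Mstar) \<and>
               (\<forall>\<mu>s \<mu>. (\<forall>n. \<mu>s n \<in> P_mom_le (\<beta> + \<theta>1 - 1) Mstar) \<and> \<mu> \<in> P_mom_le (\<beta> + \<theta>1 - 1) Mstar
                   \<and> weak_conv_seq \<mu>s \<mu> \<longrightarrow>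
                   weak_conv_seq (\<lambda>n. ipm_of \<nu> b W (\<mu>s n)) (ipm_of \<nu> b W \<mu>))"
  shows "\<exists>\<pi>. mv_stationary \<nu> b W \<pi> \<and> moment \<pi> (\<beta> + \<theta>1 - 1) < \<infinity>"
proof -
  define p where "p = \<beta> + \<theta>1 - 1"
  \<comment> \<open>The bound on \<theta>1 gives \<open>p \<ge> \<beta> / 2\<close>.\<close>
  have p: "p > 0" using \<beta> \<theta>1 by (simp add: p_def)
  obtain M where M: "M > 0"
    and self: "\<forall>\<mu>\<in>P_mom_le p M. ipm_of \<nu> b W \<mu> \<in> P_mom_le p M"
    and cont: "\<forall>\<mu>s \<mu>. (\<forall>n. \<mu>s n \<in> P_mom_le p M) \<and> \<mu> \<in> P_mom_le p M \<and> weak_conv_seq \<mu>s \<mu> \<longrightarrow>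
      weak_conv_seq (\<lambda>n. ipm_of \<nu> b W (\<mu>s n)) (ipm_of \<nu> b W \<mu>)"
    using A3 unfolding p_def[symmetric] by (elim exE conjE) (rule that)
  have "\<exists>\<pi>\<in>P_mom_le p M. ipm_of \<nu> b W \<pi> = \<pi>"
    by (rule weakly_continuous_fixed_point[OF _ _ p M]) (simp_all add: self cont)
  then obtain \<pi> where \<pi>: "\<pi> \<in> P_mom_le p M" and fixed: "ipm_of \<nu> b W \<pi> = \<pi>" ..
  have fin: "moment \<pi> p < \<infinity>"
    using \<pi> by (auto simp: P_mom_le_def intro: le_less_trans)
  then have "\<pi> \<in> P_mom p" using \<pi> by (simp add: P_mom_def P_mom_le_def)
  then have ex: "lin_strong_existence \<nu> b \<pi> W" and uniq: "\<exists>!\<pi>'. lin_ipm \<nu> b \<pi> W \<pi>'"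
    using A2[of \<pi>] unfolding p_def by auto
  \<comment> \<open>Existence and uniqueness in (A2) make the definite description in
    \<open>ipm_of\<close> denote an invariant measure, which the fixed-point equation identifies
    with \<pi>.\<close>
  have "lin_ipm \<nu> b \<pi> W \<pi>"
    using theI'[OF uniq] fixed by (simp add: ipm_of_def)
  then have "mv_stationary \<nu> b W \<pi>" by (rule frozen_fixed_point_stationary[OF wp ex])
  then show ?thesis using fin unfolding p_def by blast
qed

end
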